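(* Let $\gamma,\gamma'>0$, let $f\in\mathcal H^{\rm D}\mathcal I_\gamma^{\omega}$ and $g\in\mathcal H^{\rm D}\mathcal I_{\gamma'}^{\omega}$. Let $h$ be a complex-valued function which, together with all its $q$-derivatives $\partial^e h$ ($e\in\mathbf Z_{\ge0}$), is defined on a domain $\Omega\subset\mathbf C$, and let $x\in\Omega$ be such that, for some $R_x>0$, $|(\partial^e h)(x)|=O(R_x^e)$ as $e\to\infty$. Then $$((f*_\gamma g)*_{\gamma'}h)(x)=(f*_\gamma(g*_{\gamma'}h))(x).$$ In particular, the equality holds for every $x\in\Omega$ if $h$ is analytic on a starlike domain $\Omega$ centered at $0$, and it holds for every $x\in L(\gamma'')$ if $h\in\mathcal H^{\rm D}\mathcal I_{\gamma''}^{\infty}$ ($\gamma''>0$).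
   Context: Fix $0<q<1$. $[e]_q=\frac{1-q^e}{1-q}$, $[e]_q!=[1]_q\cdots[e]_q$. The $q$-derivative is $(\partial f)(x)=\frac{f(x)-f(qx)}{(1-q)x}$ for $x\ne0$ (so $(\partial^e h)(x)$ is defined as soon as $h$ is defined at $x,qx,\dots,q^ex$); for functions holomorphic near $0$ its value at $0$ is given by analytic continuation. "Domain" here means a set of points on which the functions in question are defined (for instance a $q$-lattice). For $\gamma>0$ let $L(\gamma)=\{\pm q^k\gamma\mid k\in\mathbf Z\}$ and $\int_\gamma f=(1-q)\sum_{k\in\mathbf Z}\sum_{\epsilon=\pm1}q^k\gamma f(\epsilon q^k\gamma)$ when the sum converges absolutely. $\mathcal I_\gamma$ is the space of functions on $L(\gamma)$ for which it converges absolutely; $\mathcal I_\gamma^\infty$ is the space of $f$ with $x\mapsto f(x)x^e$ in $\mathcal I_\gamma$ for all $e\in\mathbf Z_{\ge0}$. For $f\in\mathcal I_\gamma^\infty$ the moments are $\mu_{e,\gamma}(f)=q^{(e^2+e)/2}\int_\gamma f(x)x^e$. $q$-convolution: for $f\in\mathcal I_\gamma^\infty$ and a function $g$ on a subset of $\mathbf C$, $(f*_\gamma g)(x)=\sum_{e=0}^\infty\frac{(-1)^e\mu_{e,\gamma}(f)}{[e]_q!}(\partial^e g)(x)$, for those $x$ at which all $(\partial^eg)(x)$ are defined and the series converges absolutely. $\mathcal I_{\gamma}^{\omega}$ is the set of $f\in\mathcal I_\gamma^\infty$ such that for some $\alpha,b>0$, $|\mu_{e,\gamma}(f)|=O(q^{\alpha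 e^2/2}b^e)$ as $e\to\infty$. $\mathcal H^{\rm D}\mathcal I$ (for $\mathcal I=\mathcal I_\gamma^\infty,\mathcal I_\gamma^\omega$) is the set of functions $f\in\mathcal I$ on $L(\gamma)$ which coincide, at the points of $L(\gamma)$ in some disk centered at $0$, with a function holomorphic on that disk; $f$ is also identified with this holomorphic function on the disk. *)

theory Defs
  imports "HOL-Complex_Analysis.Complex_Analysis" "HOL-Library.Landau_Symbols"
begin

text \<open>
  Functions defined on subsets of the complex plane are partial maps of type
  \<open>complex \<rightharpoonup> complex\<close>; ``defined at \<open>x\<close>'' means \<open>x \<in> dom f\<close>.  The real parameter \<open>q\<close>
  (always with \<open>0 < q < 1\<close>) is an explicit argument.
\<close>

definition qnum :: "real \<Rightarrow> nat \<Rightarrow> real" where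
  "qnum q e = (1 - q ^ e) / (1 - q)"

definition qfact :: "real \<Rightarrow> nat \<Rightarrow> real" where
  "qfact q e = (\<Prod>k = 1..e. qnum q k)"

text \<open>Analyticity at every point of \<open>S\<close> (cf.\ \<open>analytic_on_holomorphic\<close>), where the neighbourhood
  has to lie inside the domain of the partial map.\<close>

definition pfun_analytic_on :: "(complex \<rightharpoonup> complex) \<Rightarrow> complex set \<Rightarrow> bool" where
  "pfun_analytic_on h S \<longleftrightarrow>
     (\<exists>U. open U \<and> S \<subseteq> U \<and> U \<subseteq> dom h \<and> (\<lambda>x. the (h x)) holomorphic_on U)"

text \<open>At \<open>0\<close> the \<open>q\<close>-derivative is only defined for functions holomorphic near \<open>0\<close>; the difference
  quotient then has a removable singularity at \<open>0\<close>, and its analytic continuation takes there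
  the value of the limit.\<close>

definition qderiv :: "real \<Rightarrow> (complex \<rightharpoonup> complex) \<Rightarrow> (complex \<rightharpoonup> complex)" where
  "qderiv q f =
     (let D = (\<lambda>x. (the (f x) - the (f (of_real q * x))) / (of_real (1 - q) * x))
      in (\<lambda>x. if x \<noteq> 0
                then (if x \<in> dom f \<and> of_real q * x \<in> dom f then Some (D x) else None)
                else (if pfun_analytic_on f {0} then Some (Lim (at 0) D) else None)))"

definition qlattice :: "real \<Rightarrow> real \<Rightarrow> complex set" where
  "qlattice q \<gamma> = {of_real (\<epsilon> * q powi k * \<gamma>) | \<epsilon> k. \<epsilon> \<in> {1, -1}}"

definition qint_term :: "real \<Rightarrow> real \<Rightarrow> (complex \<Rightarrow> complex) \<Rightarrow> int \<times> real \<Rightarrow> complex" where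
  "qint_term q \<gamma> F = (\<lambda>(k, \<epsilon>). of_real (q powi k * \<gamma>) * F (of_real (\<epsilon> * q powi k * \<gamma>)))"

definition qintegrable :: "real \<Rightarrow> real \<Rightarrow> (complex \<Rightarrow> complex) \<Rightarrow> bool" where
  "qintegrable q \<gamma> F \<longleftrightarrow> (\<lambda>p. norm (qint_term q \<gamma> F p)) summable_on (UNIV \<times> {1, -1})"

definition qintegral :: "real \<Rightarrow> real \<Rightarrow> (complex \<Rightarrow> complex) \<Rightarrow> complex" where
  "qintegral q \<gamma> F = of_real (1 - q) * (\<Sum>\<^sub>\<infinity>p\<in>UNIV \<times> {1, -1}. qint_term q \<gamma> F p)"

text \<open>A partial map is regarded as a function on \<open>L(\<gamma>)\<close> by restriction, so only
  \<open>L(\<gamma>) \<subseteq> dom f\<close> is required; values off \<open>L(\<gamma>)\<close> (for instance those of a holomorphic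
  extension to a disk) are allowed and play no role in membership.\<close>

definition I_inf :: "real \<Rightarrow> real \<Rightarrow> (complex \<rightharpoonup> complex) set" where
  "I_inf q \<gamma> = {f. qlattice q \<gamma> \<subseteq> dom f \<and> (\<forall>e::nat. qintegrable q \<gamma> (\<lambda>x. the (f x) * x ^ e))}"

definition qmoment :: "real \<Rightarrow> real \<Rightarrow> nat \<Rightarrow> (complex \<rightharpoonup> complex) \<Rightarrow> complex" where
  "qmoment q \<gamma> e f = of_real (q ^ ((e\<^sup>2 + e) div 2)) * qintegral q \<gamma> (\<lambda>x. the (f x) * x ^ e)"

definition I_omega :: "real \<Rightarrow> real \<Rightarrow> (complex \<rightharpoonup> complex) set" where
  "I_omega q \<gamma> = {f \<in> I_inf q \<gamma>. \<exists>\<alpha>>0. \<exists>b>0.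
     (\<lambda>e. norm (qmoment q \<gamma> e f)) \<in> O(\<lambda>e. q powr (\<alpha> * real e ^ 2 / 2) * b ^ e)}"

definition HD :: "real \<Rightarrow> real \<Rightarrow> (complex \<rightharpoonup> complex) set \<Rightarrow> (complex \<rightharpoonup> complex) set" where
  "HD q \<gamma> A = {f \<in> A. \<exists>r>0. \<exists>F. F holomorphic_on ball 0 r \<and>
     (\<forall>x \<in> qlattice q \<gamma> \<inter> ball 0 r. f x = Some (F x))}"

definition qconv_term ::
  "real \<Rightarrow> real \<Rightarrow> (complex \<rightharpoonup> complex) \<Rightarrow> (complex \<rightharpoonup> complex) \<Rightarrow> complex \<Rightarrow> nat \<Rightarrow> complex" where
  "qconv_term q \<gamma> f g x e =
     (-1) ^ e * qmoment q \<gamma> e f / of_real (qfact q e) * the ((qderiv q ^^ e) g x)"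

text \<open>The \<open>q\<close>-convolution is a partial map: it is undefined everywhere unless the first argument
  lies in \<open>I_inf q \<gamma>\<close>.\<close>

definition qconv ::
  "real \<Rightarrow> real \<Rightarrow> (complex \<rightharpoonup> complex) \<Rightarrow> (complex \<rightharpoonup> complex) \<Rightarrow> (complex \<rightharpoonup> complex)" where
  "qconv q \<gamma> f g = (\<lambda>x.
     if f \<in> I_inf q \<gamma> \<and> (\<forall>e. x \<in> dom ((qderiv q ^^ e) g)) \<and>
        summable (\<lambda>e. norm (qconv_term q \<gamma> f g x e))
     then Some (\<Sum>e. qconv_term q \<gamma> f g x e) else None)"

text \<open>Equality of two partial maps at \<open>x\<close>, including that both are defined there.\<close>

definition eq_at :: "(complex \<rightharpoonup> complex) \<Rightarrow> (complex \<rightharpoonup> complex) \<Rightarrow> complex \<Rightarrow> bool" where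
  "eq_at u v x \<longleftrightarrow> (\<exists>y. u x = Some y \<and> v x = Some y)"

end

(*
  The q-moments of f *_gamma g form the binomial convolution of those of f and g: integration by
  parts against the q-derivative gives mu_m(d^e g) = (-1)^e [m]!/[m-e]! mu_{m-e}(g), and the double
  sum over the lattice and the order of differentiation may be interchanged because the weighted
  l^1 norms of d^e g over the lattice grow only geometrically in e, whereas the moments of f decay
  like a Gaussian. On the other side, convolution commutes with the q-derivative, so both iterated
  convolutions at x are the sum over e and d of
  (-1)^(e+d) mu_e(f) mu_d(g) / ([e]! [d]!) * (d^(e+d) h)(x), which converges absolutely.
*)
theory Submission
  imports Defs
begin

subsection \<open>Exponentially bounded q-derivatives\<close>

text \<open>At a point x \<noteq> 0 the q-derivative sees only x and q x, so everything there can be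
  done on the single orbit x, q x, q^2 x, ..., term by term and without limits. At 0 the
  q-derivative is itself a limit, and the convolution needs a holomorphic representative before it
  can be differentiated there at all; hence the separate treatment of holomorphic functions on a
  disk. The same local theory supplies pointwise growth bounds: near 0 from the maximum principle,
  at a rate independent of the order of differentiation, and farther out by finitely many steps
  along the orbit. Gaussian decay of the moments is used only as summability against every geometric
  sequence. This condition passes at once to Cauchy products, so the convolution of f and g never
  has to be placed in \<open>I_omega\<close>. Holomorphy of g near 0 makes the integral of its
  q-derivatives vanish: the two halves of the lattice approach 0 with the same limit and contribute
  it with opposite signs.\<close>

lemma qnum_ge_1: "0 < q \<Longrightarrow> q < 1 \<Longrightarrow> 1 \<le> qnum q (Suc n)"
  unfolding qnum_def using power_decreasing[of 1 "Suc n" q] by (simp add: field_simps)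

lemma qfact_Suc: "qfact q (Suc n) = qnum q (Suc n) * qfact q n"
  by (simp add: qfact_def mult.commute)

lemma qfact_ge_1: "0 < q \<Longrightarrow> q < 1 \<Longrightarrow> 1 \<le> qfact q n"
proof (induction n)
  case (Suc n)
  then show ?case
    using mult_mono[of 1 "qnum q (Suc n)" 1 "qfact q n"] qnum_ge_1[of q n] by (simp add: qfact_Suc)
qed (simp add: qfact_def)

text \<open>Coefficients of the convolution as a power series in the q-derivative. Dividing by the
  q-factorial turns the q-binomial convolution of moments into a plain Cauchy product.\<close>

definition qcoeff :: "real \<Rightarrow> real \<Rightarrow> (complex \<rightharpoonup> complex) \<Rightarrow> nat \<Rightarrow> complex" where
  "qcoeff q \<gamma> f e = (-1) ^ e * qmoment q \<gamma> e f / of_real (qfact q e)"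

text \<open>The common target of all three cases of the theorem. The bound holds for every order,
  not just asymptotically, so that it can be inserted directly into majorants of series.\<close>

definition qexp_bounded :: "real \<Rightarrow> (complex \<rightharpoonup> complex) \<Rightarrow> complex \<Rightarrow> bool" where
  "qexp_bounded q h x \<longleftrightarrow> (\<forall>e. x \<in> dom ((qderiv q ^^ e) h)) \<and>
     (\<exists>R>0. \<exists>C. \<forall>e. norm (the ((qderiv q ^^ e) h x)) \<le> C * R ^ e)"

lemma funpow_qderiv_shift:
  "(qderiv q ^^ e) ((qderiv q ^^ d) h) = (qderiv q ^^ (e + d)) h"
  by (simp add: funpow_add)

lemma qexp_boundedI:
  assumes "\<And>e. x \<in> dom ((qderiv q ^^ e) h)" "R > 0"
    and "\<And>e. norm (the ((qderiv q ^^ e) h x)) \<le> C * R ^ e"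
  shows "qexp_bounded q h x"
  using assms unfolding qexp_bounded_def by blast

text \<open>Positivity of \<open>v\<close> lets the constant absorb the finitely many indices that
  the asymptotic bound does not reach.\<close>

lemma bigo_exp_bound:
  fixes u :: "nat \<Rightarrow> real" and v :: "nat \<Rightarrow> real"
  assumes "u \<in> O(v)" "\<And>n. 0 < v n"
  obtains C where "C > 0" "\<And>n. \<bar>u n\<bar> \<le> C * v n"
proof -
  from landau_o.bigE[OF assms(1)] obtain c where c: "c > 0"
    "eventually (\<lambda>n. norm (u n) \<le> c * norm (v n)) sequentially" by blast
  then obtain N where N: "\<And>n. n \<ge> N \<Longrightarrow> norm (u n) \<le> c * norm (v n)"
    by (auto simp: eventually_sequentially)
  define C where "C = c + (\<Sum>n<N. \<bar>u n\<bar> / v n)"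
  have nonneg: "0 \<le> (\<Sum>n<N. \<bar>u n\<bar> / v n)"
    using assms(2) by (intro sum_nonneg) (simp add: less_imp_le)
  show ?thesis
  proof
    show "C > 0" using c(1) nonneg by (simp add: C_def)
    show "\<bar>u n\<bar> \<le> C * v n" for n
    proof (cases "n < N")
      case True
      have "\<bar>u n\<bar> / v n \<le> (\<Sum>n<N. \<bar>u n\<bar> / v n)"
        using True assms(2) by (intro member_le_sum) (auto simp: less_imp_le)
      then have "\<bar>u n\<bar> / v n \<le> C" using c(1) by (simp add: C_def)
      then show ?thesis using assms(2)[of n] by (simp add: field_simps)
    next
      case False
      then have "\<bar>u n\<bar> \<le> c * v n" using N[of n] assms(2)[of n] by simp
      also have "\<dots> \<le> C * v n"
        using nonneg assms(2)[of n] by (intro mult_right_mono) (auto simp: C_def)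
      finally show ?thesis .
    qed
  qed
qed

text \<open>Since q^(\<alpha> e^2/2) B^e = (q^(\<alpha> e/2) B)^e and the base tends to 0, the terms
  eventually drop below those of the geometric series of ratio 1/2. The decay of the moments enters
  the rest of the proof only in this form.\<close>

lemma I_omega_summable:
  assumes q: "0 < q" "q < 1" and f: "f \<in> I_omega q \<gamma>"
  shows "summable (\<lambda>e. norm (qcoeff q \<gamma> f e) * R ^ e)"
proof -
  from f obtain \<alpha> b where ab: "\<alpha> > 0" "b > 0"
    "(\<lambda>e. norm (qmoment q \<gamma> e f)) \<in> O(\<lambda>e. q powr (\<alpha> * real e ^ 2 / 2) * b ^ e)"
    by (auto simp: I_omega_def)
  from bigo_exp_bound[OF ab(3)] ab q obtain C where C: "C > 0"
    "\<And>e. norm (qmoment q \<gamma> e f) \<le> C * (q powr (\<alpha> * real e ^ 2 / 2) * b ^ e)"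
    by auto
  \<comment> \<open>The base \<open>\<bar>R\<bar> + 1\<close> dominates \<open>\<bar>R\<bar>\<close>
    and keeps \<open>B\<close> positive when \<open>R\<close> is 0.\<close>
  define B where "B = b * (\<bar>R\<bar> + 1)"
  have B: "B > 0" using ab by (simp add: B_def)
  have "summable (\<lambda>e. q powr (\<alpha> * real e ^ 2 / 2) * B ^ e)"
  proof (rule summable_comparison_test_ev[OF _ summable_geometric[of "1/2::real"]])
    have "(\<lambda>e. q powr (\<alpha> * real e / 2) * B) \<longlonglongrightarrow> 0"
    proof -
      have "0 < q powr (\<alpha> / 2)" "q powr (\<alpha> / 2) < 1"
        using q ab(1) powr_less_mono2[of "\<alpha> / 2" q 1] by auto
      then have "(\<lambda>e. (q powr (\<alpha> / 2)) ^ e * B) \<longlonglongrightarrow> 0"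
        by (intro tendsto_mult_left_zero LIMSEQ_power_zero) auto
      moreover have "(q powr (\<alpha> / 2)) ^ e = q powr (\<alpha> * real e / 2)" for e
        using q by (simp add: powr_power mult_ac)
      ultimately show ?thesis by simp
    qed
    then have "eventually (\<lambda>e. q powr (\<alpha> * real e / 2) * B < 1/2) sequentially"
      by (rule order_tendstoD) simp
    then show "eventually (\<lambda>e. norm (q powr (\<alpha> * real e ^ 2 / 2) * B ^ e) \<le> (1/2) ^ e) sequentially"
    proof eventually_elim
      case (elim e)
      have "(q powr (\<alpha> * real e / 2)) ^ e = q powr (\<alpha> * real e ^ 2 / 2)"
        using q by (simp add: powr_power power2_eq_square mult_ac)
      then have "q powr (\<alpha> * real e ^ 2 / 2) * B ^ e = (q powr (\<alpha> * real e / 2) * B) ^ e"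
        by (simp add: power_mult_distrib)
      also have "\<dots> \<le> (1/2) ^ e"
        using elim B by (intro power_mono) auto
      finally show ?case using B by simp
    qed
  qed simp
  then have "summable (\<lambda>e. C * (q powr (\<alpha> * real e ^ 2 / 2) * B ^ e))"
    by (rule summable_mult)
  then show ?thesis
  proof (rule summable_comparison_test')
    fix e
    have "norm (qcoeff q \<gamma> f e) \<le> norm (qmoment q \<gamma> e f)"
      using qfact_ge_1[OF q, of e]
      by (simp add: qcoeff_def norm_mult norm_divide norm_power divide_le_eq mult_le_cancel_left1)
    also note C(2)[of e]
    finally have "norm (qcoeff q \<gamma> f e) * \<bar>R\<bar> ^ e \<le>
        C * (q powr (\<alpha> * real e ^ 2 / 2) * b ^ e) * (\<bar>R\<bar> + 1) ^ e"
      using C(1) ab(2) by (intro mult_mono power_mono) auto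
    then show "norm (norm (qcoeff q \<gamma> f e) * R ^ e) \<le> C * (q powr (\<alpha> * real e ^ 2 / 2) * B ^ e)"
      by (simp add: B_def power_mult_distrib power_abs abs_mult mult_ac)
  qed
qed

lemma qconv_eq:
  assumes "summable (\<lambda>e. norm (qcoeff q \<gamma> f e * the ((qderiv q ^^ e) g x)))"
    and "f \<in> I_inf q \<gamma>" "\<And>e. x \<in> dom ((qderiv q ^^ e) g)"
  shows "qconv q \<gamma> f g x = Some (\<Sum>e. qcoeff q \<gamma> f e * the ((qderiv q ^^ e) g x))"
proof -
  have "qconv_term q \<gamma> f g x = (\<lambda>e. qcoeff q \<gamma> f e * the ((qderiv q ^^ e) g x))"
    by (simp add: fun_eq_iff qconv_term_def qcoeff_def)
  then show ?thesis using assms by (simp add: qconv_def)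
qed

lemma summable_exp_bounded:
  fixes c u :: "nat \<Rightarrow> complex"
  assumes "\<And>R::real. summable (\<lambda>e. norm (c e) * R ^ e)" "\<And>e. norm (u e) \<le> C * R ^ e"
  shows "summable (\<lambda>e. norm (c e * u e))"
proof (rule summable_comparison_test'[OF summable_mult[OF assms(1)[of R], of C]])
  show "norm (norm (c e * u e)) \<le> C * (norm (c e) * R ^ e)" for e
    using mult_left_mono[OF assms(2)[of e] norm_ge_zero[of "c e"]] by (simp add: norm_mult mult_ac)
qed

lemma I_omega_I_inf: "f \<in> I_omega q \<gamma> \<Longrightarrow> f \<in> I_inf q \<gamma>"
  by (simp add: I_omega_def)

lemma qconv_exp_bounded:
  assumes "0 < q" "q < 1" "f \<in> I_omega q \<gamma>" "qexp_bounded q h x"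
  shows "qconv q \<gamma> f h x = Some (\<Sum>e. qcoeff q \<gamma> f e * the ((qderiv q ^^ e) h x))"
    and "summable (\<lambda>e. norm (qcoeff q \<gamma> f e * the ((qderiv q ^^ e) h x)))"
proof -
  from assms(4) obtain R C where RC: "\<And>e. norm (the ((qderiv q ^^ e) h x)) \<le> C * R ^ e"
    by (auto simp: qexp_bounded_def)
  show *: "summable (\<lambda>e. norm (qcoeff q \<gamma> f e * the ((qderiv q ^^ e) h x)))"
    using I_omega_summable[OF assms(1-3)] RC by (rule summable_exp_bounded)
  show "qconv q \<gamma> f h x = Some (\<Sum>e. qcoeff q \<gamma> f e * the ((qderiv q ^^ e) h x))"
    using assms * by (intro qconv_eq) (auto simp: qexp_bounded_def I_omega_I_inf)
qed

lemma qderiv_nonzero: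
  assumes "x \<noteq> 0" "x \<in> dom h" "of_real q * x \<in> dom h"
  shows "qderiv q h x = Some ((the (h x) - the (h (of_real q * x))) / (of_real (1 - q) * x))"
  using assms by (simp add: qderiv_def Let_def)

lemma qderiv_nonzero_dom:
  assumes "x \<noteq> 0"
  shows "x \<in> dom (qderiv q h) \<longleftrightarrow> x \<in> dom h \<and> of_real q * x \<in> dom h"
  using assms by (auto simp: qderiv_def Let_def split: if_splits)

lemma qderiv_cong:
  assumes "x \<noteq> 0" "u x = v x" "u (of_real q * x) = v (of_real q * x)"
  shows "qderiv q u x = qderiv q v x"
  using assms by (simp add: qderiv_def Let_def dom_def)

lemma qexp_bounded_qderiv:
  assumes "qexp_bounded q h x" shows "qexp_bounded q (qderiv q h) x"
proof -
  have shift: "(qderiv q ^^ e) (qderiv q h) = (qderiv q ^^ Suc e) h" for e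
    by (simp add: funpow_swap1)
  from assms obtain R C where RC: "R > 0" "\<And>e. norm (the ((qderiv q ^^ e) h x)) \<le> C * R ^ e"
    by (auto simp: qexp_bounded_def)
  have "norm (the ((qderiv q ^^ Suc e) h x)) \<le> (C * R) * R ^ e" for e
    using RC(2)[of "Suc e"] by (simp only: power_Suc mult_ac)
  moreover have "x \<in> dom ((qderiv q ^^ Suc e) h)" for e
    using assms unfolding qexp_bounded_def by blast
  ultimately show ?thesis unfolding qexp_bounded_def shift
    using RC(1) by blast
qed

lemma qexp_bounded_funpow:
  "qexp_bounded q h x \<Longrightarrow> qexp_bounded q ((qderiv q ^^ e) h) x"
  by (induction e) (auto simp: qexp_bounded_qderiv)

text \<open>Solving the difference quotient for its second value gives D_e(q x) = D_e(x) - (1 - q) x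
  D_(e+1)(x), where D_e is the q-derivative of order e. The rate \<open>R\<close> is kept and only
  the constant grows.\<close>

lemma qexp_bounded_scale:
  assumes q: "0 < q" "q < 1" and h: "qexp_bounded q h x" and x: "x \<noteq> 0"
  shows "qexp_bounded q h (of_real q * x)"
proof -
  let ?D = "\<lambda>e. (qderiv q ^^ e) h"
  from h obtain R C where RC: "R > 0" "\<And>e. norm (the (?D e x)) \<le> C * R ^ e"
    and d: "\<And>e. x \<in> dom (?D e)"
    by (auto simp: qexp_bounded_def)
  have dq: "of_real q * x \<in> dom (?D e)" for e
    using d[of "Suc e"] qderiv_nonzero_dom[OF x, of q "?D e"] by simp
  have "norm (the (?D e (of_real q * x))) \<le> (C + (1 - q) * norm x * C * R) * R ^ e" for e
  proof -
    have "the (?D (Suc e) x) * (of_real (1 - q) * x) = the (?D e x) - the (?D e (of_real q * x))"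
      using qderiv_nonzero[OF x d[of e] dq[of e]] q x by simp
    then have "the (?D e (of_real q * x)) = the (?D e x) - the (?D (Suc e) x) * (of_real (1 - q) * x)"
      by (simp add: algebra_simps)
    then have "norm (the (?D e (of_real q * x))) \<le>
        norm (the (?D e x)) + norm (the (?D (Suc e) x)) * ((1 - q) * norm x)"
      using norm_triangle_ineq4[of "the (?D e x)" "the (?D (Suc e) x) * (of_real (1 - q) * x)"] q
      by (simp only: norm_mult norm_of_real)
    also have "\<dots> \<le> C * R ^ e + C * R ^ Suc e * ((1 - q) * norm x)"
      using q by (intro add_mono mult_right_mono RC) auto
    also have "\<dots> = (C + (1 - q) * norm x * C * R) * R ^ e"
      by (simp add: algebra_simps)
    finally show ?thesis .
  qed
  then show ?thesis unfolding qexp_bounded_def using dq RC(1) by blast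
qed

text \<open>For x \<noteq> 0 the q-derivative is a finite linear combination of the values at x and
  q x, so it can be taken under the two convergent series term by term.\<close>

lemma qderiv_qconv_nonzero:
  assumes q: "0 < q" "q < 1" and g: "g \<in> I_omega q \<gamma>" and h: "qexp_bounded q h x" and x: "x \<noteq> 0"
  shows "qderiv q (qconv q \<gamma> g h) x = qconv q \<gamma> g (qderiv q h) x"
proof -
  let ?D = "\<lambda>e. (qderiv q ^^ e) h" and ?c = "qcoeff q \<gamma> g" and ?y = "of_real q * x"
  note hq = qexp_bounded_scale[OF q h x] and hd = qexp_bounded_qderiv[OF h]
  have s1: "summable (\<lambda>e. ?c e * the (?D e x))" and s2: "summable (\<lambda>e. ?c e * the (?D e ?y))"
    by (rule summable_norm_cancel[OF qconv_exp_bounded(2)[OF q g h]],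
        rule summable_norm_cancel[OF qconv_exp_bounded(2)[OF q g hq]])
  have "the (?D (Suc e) x) = (the (?D e x) - the (?D e ?y)) / (of_real (1 - q) * x)" for e
    using qderiv_nonzero[OF x, of "?D e" q] h hq by (simp add: qexp_bounded_def)
  then have "qconv q \<gamma> g (qderiv q h) x =
      Some (\<Sum>e. (?c e * the (?D e x) - ?c e * the (?D e ?y)) / (of_real (1 - q) * x))"
    using qconv_exp_bounded(1)[OF q g hd] by (simp add: funpow_swap1 algebra_simps)
  also have "\<dots> = Some (((\<Sum>e. ?c e * the (?D e x)) - (\<Sum>e. ?c e * the (?D e ?y))) / (of_real (1 - q) * x))"
    using s1 s2 by (simp only: suminf_diff suminf_divide summable_diff)
  also have "\<dots> = qderiv q (qconv q \<gamma> g h) x"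
    using x qconv_exp_bounded(1)[OF q g h] qconv_exp_bounded(1)[OF q g hq]
    by (subst qderiv_nonzero) auto
  finally show ?thesis ..
qed

lemma funpow_qderiv_qconv_nonzero:
  assumes q: "0 < q" "q < 1" and g: "g \<in> I_omega q \<gamma>" and h: "qexp_bounded q h x" and x: "x \<noteq> 0"
  shows "(qderiv q ^^ e) (qconv q \<gamma> g h) x = qconv q \<gamma> g ((qderiv q ^^ e) h) x"
  using h x
proof (induction e arbitrary: x)
  case (Suc e)
  \<comment> \<open>The induction hypothesis is used at x and at q x, the only two points that
    \<open>qderiv_cong\<close> compares; this is why x is generalised in the induction.\<close>
  have "(qderiv q ^^ Suc e) (qconv q \<gamma> g h) x = qderiv q (qconv q \<gamma> g ((qderiv q ^^ e) h)) x"
    using Suc q by (auto intro!: qderiv_cong simp: qexp_bounded_scale)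
  also have "\<dots> = qconv q \<gamma> g ((qderiv q ^^ Suc e) h) x"
    using qderiv_qconv_nonzero[OF q g qexp_bounded_funpow[OF Suc.prems(1)] Suc.prems(2)] by simp
  finally show ?case .
qed simp

subsection \<open>The q-derivative of a holomorphic function\<close>

text \<open>With s(z) = (F z - F 0) / z, continued to 0 by F'(0), one has F x - F (q x) = x s(x) - q
  x s(q x). Cancelling x leaves a formula that is holomorphic at 0 as well.\<close>

definition hqderiv :: "real \<Rightarrow> (complex \<Rightarrow> complex) \<Rightarrow> complex \<Rightarrow> complex" where
  "hqderiv q F = (let s = (\<lambda>z. if z = 0 then deriv F 0 else (F z - F 0) / (z - 0))
     in (\<lambda>x. (s x - of_real q * s (of_real q * x)) / of_real (1 - q)))"

lemma hqderiv_nonzero: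
  assumes "0 < q" "q < 1" "x \<noteq> 0"
  shows "hqderiv q F x = (F x - F (of_real q * x)) / (of_real (1 - q) * x)"
proof -
  have "hqderiv q F x = ((F x - F 0) / x - (F (of_real q * x) - F 0) / x) / of_real (1 - q)"
    using assms by (simp add: hqderiv_def Let_def)
  also have "\<dots> = (F x - F (of_real q * x)) / (of_real (1 - q) * x)"
    by (simp add: diff_divide_distrib[symmetric] mult.commute del: of_real_diff)
  finally show ?thesis .
qed

lemma scale_ball:
  assumes "0 < q" "q < 1" "x \<in> ball 0 r"
  shows "complex_of_real q * x \<in> ball 0 r"
  using assms mult_right_mono[of q 1 "norm x"] by (simp add: norm_mult)

lemma hqderiv_holomorphic:
  assumes "0 < q" "q < 1" "F holomorphic_on ball 0 r"
  shows "hqderiv q F holomorphic_on ball 0 r"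
proof -
  define s where "s = (\<lambda>z. if z = 0 then deriv F 0 else (F z - F 0) / (z - 0))"
  have s: "s holomorphic_on ball 0 r"
    unfolding s_def using assms by (intro pole_lemma_open) auto
  have "(s \<circ> (\<lambda>x. of_real q * x)) holomorphic_on ball 0 r"
    using scale_ball[OF assms(1,2)]
    by (intro holomorphic_on_compose_gen[OF _ s] holomorphic_intros) auto
  then have "(\<lambda>x. s (of_real q * x)) holomorphic_on ball 0 r"
    by (simp add: o_def)
  then have "(\<lambda>x. (s x - of_real q * s (of_real q * x)) / of_real (1 - q))
      holomorphic_on ball 0 r"
    using s assms by (intro holomorphic_intros) auto
  then show ?thesis by (simp add: hqderiv_def s_def[symmetric] Let_def)
qed

lemma funpow_hqderiv_holomorphic:
  assumes "0 < q" "q < 1" "F holomorphic_on ball 0 r"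
  shows "(hqderiv q ^^ e) F holomorphic_on ball 0 r"
  by (induction e) (use assms in \<open>auto intro: hqderiv_holomorphic\<close>)

text \<open>On the circle of radius \<open>\<rho>\<close> the difference quotient at most multiplies the sup norm by
  \<open>2 / ((1 - q) * \<rho>)\<close>; the maximum principle extends this to the disk, so no radius is lost when
  iterating.\<close>

lemma hqderiv_bound:
  assumes q: "0 < q" "q < 1" and F: "F holomorphic_on ball 0 r" and \<rho>: "0 < \<rho>" "\<rho> < r"
    and B: "\<And>x. x \<in> cball 0 \<rho> \<Longrightarrow> norm (F x) \<le> B" and x: "x \<in> cball 0 \<rho>"
  shows "norm (hqderiv q F x) \<le> B * (2 / ((1 - q) * \<rho>))"
proof (rule maximum_modulus_frontier[of "hqderiv q F" "cball 0 \<rho>"])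
  have hol: "hqderiv q F holomorphic_on cball 0 \<rho>"
    using \<rho> by (intro holomorphic_on_subset[OF hqderiv_holomorphic[OF q F]]) auto
  then show "hqderiv q F holomorphic_on interior (cball 0 \<rho>)"
    by (rule holomorphic_on_subset) auto
  from hol show "continuous_on (closure (cball 0 \<rho>)) (hqderiv q F)"
    by (simp add: holomorphic_on_imp_continuous_on)
  fix z :: complex
  assume "z \<in> frontier (cball 0 \<rho>)"
  then have z: "norm z = \<rho>" using \<rho> by simp
  have "norm (F z - F (of_real q * z)) \<le> B + B"
    using z q \<rho> by (intro norm_triangle_le_diff add_mono B) (auto simp: norm_mult mult_le_cancel_right1)
  moreover have "norm (hqderiv q F z) = norm (F z - F (of_real q * z)) / ((1 - q) * \<rho>)"
    using z q \<rho> hqderiv_nonzero[OF q, of z F] by (auto simp: norm_divide norm_mult simp del: of_real_diff)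
  ultimately show "norm (hqderiv q F z) \<le> B * (2 / ((1 - q) * \<rho>))"
    using q \<rho> by (simp add: divide_right_mono)
qed (use x in auto)

lemma funpow_hqderiv_bound:
  assumes q: "0 < q" "q < 1" and F: "F holomorphic_on ball 0 r" and \<rho>: "0 < \<rho>" "\<rho> < r"
  shows "\<exists>B\<ge>0. \<forall>e. \<forall>x \<in> cball 0 \<rho>. norm ((hqderiv q ^^ e) F x) \<le> B * (2 / ((1 - q) * \<rho>)) ^ e"
proof -
  have "continuous_on (cball 0 \<rho>) F"
    using \<rho> by (intro holomorphic_on_imp_continuous_on holomorphic_on_subset[OF F]) auto
  then have "compact (F ` cball 0 \<rho>)" by (rule compact_continuous_image) simp
  then obtain B where B: "\<And>x. x \<in> cball 0 \<rho> \<Longrightarrow> norm (F x) \<le> B"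
    using that by (fastforce dest!: compact_imp_bounded simp: bounded_iff)
  have "0 \<le> B" using B[of 0] \<rho> norm_ge_zero[of "F 0"] by (simp del: norm_ge_zero)
  moreover have "norm ((hqderiv q ^^ e) F x) \<le> B * (2 / ((1 - q) * \<rho>)) ^ e"
    if "x \<in> cball 0 \<rho>" for e x
    using that
  proof (induction e arbitrary: x)
    case (Suc e)
    then show ?case
      using hqderiv_bound[OF q funpow_hqderiv_holomorphic[OF q F] \<rho> Suc.IH Suc.prems] by (simp add: mult_ac)
  qed (use B in simp)
  ultimately show ?thesis by blast
qed

text \<open>The orbit x, q x, q^2 x, ... stays in \<open>S\<close> and in the ball and avoids 0, so
  agreement of \<open>h\<close> and \<open>F\<close> at the points of \<open>S\<close> alone fixes
  all q-derivatives there.\<close>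

lemma funpow_qderiv_lattice:
  assumes q: "0 < q" "q < 1" and "\<And>x. x \<in> S \<Longrightarrow> x \<noteq> 0 \<and> of_real q * x \<in> S"
    and "\<And>x. x \<in> S \<Longrightarrow> x \<in> ball 0 r \<Longrightarrow> h x = Some (F x)" and "x \<in> S" "x \<in> ball 0 r"
  shows "(qderiv q ^^ e) h x = Some ((hqderiv q ^^ e) F x)"
  using assms(5,6)
proof (induction e arbitrary: x)
  case (Suc e)
  have "of_real q * x \<in> S" "of_real q * x \<in> ball 0 r" "x \<noteq> 0"
    using Suc.prems assms(3) scale_ball[OF q] by auto
  then show ?case
    using Suc by (simp add: qderiv_nonzero hqderiv_nonzero[OF q] dom_def)
qed (use assms in auto)

lemma qderiv_ball:
  assumes q: "0 < q" "q < 1" and F: "F holomorphic_on ball 0 r"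
    and h: "\<And>x. x \<in> ball 0 r \<Longrightarrow> h x = Some (F x)" and x: "x \<in> ball 0 r"
  shows "qderiv q h x = Some (hqderiv q F x)"
proof (cases "x = 0")
  case False
  then show ?thesis using x scale_ball[OF q x] by (simp add: qderiv_nonzero hqderiv_nonzero[OF q] dom_def h)
next
  case True
  define D where "D = (\<lambda>x. (the (h x) - the (h (of_real q * x))) / (of_real (1 - q) * x))"
  from x have r: "0 < r" by (simp add: True)
  have "(\<lambda>x. the (h x)) holomorphic_on ball 0 r"
    by (rule holomorphic_transform[OF F]) (simp add: h)
  then have "pfun_analytic_on h {0}"
    unfolding pfun_analytic_on_def using h r by (intro exI[of _ "ball 0 r"]) auto
  then have "qderiv q h 0 = Some (Lim (at 0) D)"
    by (simp add: qderiv_def D_def)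
  \<comment> \<open>The limit is read off from \<open>hqderiv q F\<close>, which is continuous at 0
    and equals \<open>D\<close> on the punctured ball.\<close>
  also have "Lim (at 0) D = hqderiv q F 0"
  proof (rule tendsto_Lim)
    have "isCont (hqderiv q F) 0"
      using hqderiv_holomorphic[OF q F] r
      by (intro continuous_on_interior[OF holomorphic_on_imp_continuous_on]) auto
    then have "hqderiv q F \<midarrow>0\<rightarrow> hqderiv q F 0"
      by (simp add: isCont_def)
    moreover have "eventually (\<lambda>y. hqderiv q F y = D y) (at 0)"
      unfolding eventually_at
    proof (intro exI[of _ r] conjI ballI impI)
      fix y :: complex assume "y \<noteq> 0 \<and> dist y 0 < r"
      then have "y \<noteq> 0" "y \<in> ball 0 r" by (auto simp: dist_commute)
      then show "hqderiv q F y = D y"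
        using scale_ball[OF q] by (simp add: D_def hqderiv_nonzero[OF q] h)
    qed (fact r)
    ultimately show "D \<midarrow>0\<rightarrow> hqderiv q F 0"
      by (rule Lim_transform_eventually)
  qed simp
  finally show ?thesis by (simp add: True)
qed

lemma funpow_qderiv_ball:
  assumes q: "0 < q" "q < 1" and F: "F holomorphic_on ball 0 r"
    and h: "\<And>x. x \<in> ball 0 r \<Longrightarrow> h x = Some (F x)" and x: "x \<in> ball 0 r"
  shows "(qderiv q ^^ e) h x = Some ((hqderiv q ^^ e) F x)"
  using x
proof (induction e arbitrary: x)
  case (Suc e)
  then show ?case
    using qderiv_ball[OF q funpow_hqderiv_holomorphic[OF q F]] by simp
qed (use h in auto)

section \<open>Carrying exponential bounds outward along q-orbits\<close>

lemma qexp_bounded_unscale: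
  assumes q: "0 < q" "q < 1" and h: "qexp_bounded q h (of_real q * x)" and x: "x \<noteq> 0" "x \<in> dom h"
  shows "qexp_bounded q h x"
proof -
  let ?D = "\<lambda>e. (qderiv q ^^ e) h"
  from h obtain R C where RC: "R > 0" "\<And>e. norm (the (?D e (of_real q * x))) \<le> C * R ^ e"
    and dq: "\<And>e. of_real q * x \<in> dom (?D e)"
    by (auto simp: qexp_bounded_def)
  have d: "x \<in> dom (?D e)" for e
  proof (induction e)
    case (Suc e)
    then show ?case using qderiv_nonzero_dom[OF x(1), of q "?D e"] dq[of e] by simp
  qed (use x in simp)
  \<comment> \<open>\<open>K\<close> is the factor that the difference quotient at x puts on D_e(x)
    - D_e(q x). Each of the two terms is at most B (R + 2 K)^e, so one step multiplies by at most 2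
    K; \<open>B\<close> covers both the value at order 0 and the constant \<open>C\<close>. The rate
    worsens with every step outward, which is harmless because only finitely many steps are
    taken.\<close>
  define K where "K = 1 / ((1 - q) * norm x)"
  define B where "B = norm (the (h x)) + C"
  have K: "K > 0" using q x by (simp add: K_def)
  have C: "0 \<le> C" using order_trans[OF norm_ge_zero RC(2)[of 0]] by simp
  have "norm (the (?D e x)) \<le> B * (R + 2 * K) ^ e" for e
  proof (induction e)
    case (Suc e)
    have "norm (the (?D (Suc e) x)) = norm (the (?D e x) - the (?D e (of_real q * x))) * K"
      using qderiv_nonzero[OF x(1) d[of e] dq[of e]] q
      by (simp add: K_def norm_divide norm_mult del: of_real_diff)
    also have "\<dots> \<le> (B * (R + 2 * K) ^ e + B * (R + 2 * K) ^ e) * K"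
    proof (intro mult_right_mono norm_triangle_le_diff add_mono Suc)
      have "C * R ^ e \<le> B * (R + 2 * K) ^ e"
        using RC(1) K C by (intro mult_mono power_mono) (auto simp: B_def)
      then show "norm (the (?D e (of_real q * x))) \<le> B * (R + 2 * K) ^ e"
        using RC(2)[of e] by simp
    qed (use K in simp)
    also have "\<dots> \<le> B * (R + 2 * K) ^ Suc e"
      using RC(1) K C by (simp add: algebra_simps B_def)
    finally show ?case .
  qed (use C in \<open>simp add: B_def\<close>)
  moreover have "0 < R + 2 * K" using RC(1) K by simp
  ultimately show ?thesis unfolding qexp_bounded_def using d by blast
qed

lemma qexp_bounded_unscale_power:
  assumes q: "0 < q" "q < 1" and h: "qexp_bounded q h (of_real (q ^ n) * x)"
    and x: "x \<noteq> 0" "\<And>k. of_real (q ^ k) * x \<in> dom h"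
  shows "qexp_bounded q h x"
  using h
proof (induction n)
  case (Suc n)
  have "qexp_bounded q h (of_real (q ^ n) * x)"
  proof (rule qexp_bounded_unscale[OF q])
    have "of_real (q ^ Suc n) * x = of_real q * (of_real (q ^ n) * x)"
      by (simp add: mult.assoc)
    then show "qexp_bounded q h (of_real q * (of_real (q ^ n) * x))"
      using Suc.prems by (simp only:)
  qed (use x q in auto)
  then show ?case by (rule Suc.IH)
qed simp

text \<open>Some q^n x lies in a disk where \<open>F\<close> is holomorphic, and the maximum
  principle bounds all q-derivatives there; n steps outward lead back to x. Taking for
  \<open>S\<close> a q-lattice or a starlike domain without 0 yields both special cases of the
  theorem.\<close>

lemma qexp_bounded_holomorphic:
  assumes q: "0 < q" "q < 1" and F: "F holomorphic_on ball 0 r" "0 < r"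
    and S: "\<And>x. x \<in> S \<Longrightarrow> x \<noteq> 0 \<and> of_real q * x \<in> S"
    and h: "\<And>x. x \<in> S \<Longrightarrow> x \<in> ball 0 r \<Longrightarrow> h x = Some (F x)" "S \<subseteq> dom h" and x: "x \<in> S"
  shows "qexp_bounded q h x"
proof -
  have S_pow: "of_real (q ^ k) * x \<in> S" for k
    by (induction k) (use x S in \<open>auto simp: mult.assoc\<close>)
  define \<rho> where "\<rho> = r / 2"
  have \<rho>: "0 < \<rho>" "\<rho> < r" using F by (auto simp: \<rho>_def)
  have "(\<lambda>n. q ^ n * norm x) \<longlonglongrightarrow> 0"
    using q by (intro tendsto_mult_left_zero LIMSEQ_power_zero) auto
  then obtain n where n: "q ^ n * norm x < \<rho>"
    using order_tendstoD(2)[OF _ \<rho>(1)] eventually_sequentially by (metis order_refl)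
  define y where "y = of_real (q ^ n) * x"
  have y: "y \<in> S" "y \<in> cball 0 \<rho>"
    using S_pow n q by (auto simp: y_def norm_mult norm_power)
  obtain B where B: "\<And>e. norm ((hqderiv q ^^ e) F y) \<le> B * (2 / ((1 - q) * \<rho>)) ^ e"
    using funpow_hqderiv_bound[OF q F(1) \<rho>] y by blast
  have D: "(qderiv q ^^ e) h y = Some ((hqderiv q ^^ e) F y)" for e
    using funpow_qderiv_lattice[OF q S h(1)] y \<rho> by simp
  have "0 < 2 / ((1 - q) * \<rho>)" using q \<rho> by simp
  then have "qexp_bounded q h y"
    by (rule qexp_boundedI[where C = B, rotated]) (simp_all add: D B dom_def)
  then have "qexp_bounded q h (of_real (q ^ n) * x)" by (simp only: y_def)
  then show ?thesis
  proof (rule qexp_bounded_unscale_power[OF q])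
    show "x \<noteq> 0" using S[OF x] by simp
    show "of_real (q ^ k) * x \<in> dom h" for k using S_pow h(2) by blast
  qed
qed

subsection \<open>Convolution commutes with the q-derivative\<close>

lemma qexp_bounded_ball:
  assumes q: "0 < q" "q < 1" and F: "F holomorphic_on ball 0 r"
    and h: "\<And>x. x \<in> ball 0 r \<Longrightarrow> h x = Some (F x)" and x: "x \<in> ball 0 r"
  shows "qexp_bounded q h x"
proof -
  have D: "(qderiv q ^^ e) h x = Some ((hqderiv q ^^ e) F x)" for e
    using funpow_qderiv_ball[OF q F h x] .
  \<comment> \<open>The midpoint between |x| and r gives a closed disk that contains x, lies inside
    the ball, and has positive radius even for x = 0.\<close>
  define \<rho> where "\<rho> = (norm x + r) / 2"
  have \<rho>: "0 < \<rho>" "\<rho> < r" "x \<in> cball 0 \<rho>"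
    using x norm_ge_zero[of x] by (auto simp: \<rho>_def simp del: norm_ge_zero)
  then obtain B where B: "\<And>e. norm ((hqderiv q ^^ e) F x) \<le> B * (2 / ((1 - q) * \<rho>)) ^ e"
    using funpow_hqderiv_bound[OF q F \<rho>(1,2)] by blast
  have "0 < 2 / ((1 - q) * \<rho>)" using q \<rho> by simp
  then show ?thesis
    by (rule qexp_boundedI[where C = B, rotated]) (simp_all add: D B dom_def)
qed

text \<open>On \<open>cball 0 \<rho>\<close> the sup norms of the iterates grow at most
  geometrically, so the partial sums converge uniformly. This gives the convolution a holomorphic
  representative near 0, as its q-derivative at 0 requires.\<close>

lemma suminf_hqderiv_holomorphic:
  assumes q: "0 < q" "q < 1" and F: "F holomorphic_on ball 0 r" and \<rho>: "0 < \<rho>" "\<rho> < r"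
    and c: "\<And>R::real. summable (\<lambda>e. norm (c e) * R ^ e)"
  shows "(\<lambda>x. \<Sum>e. c e * (hqderiv q ^^ e) F x) holomorphic_on ball 0 \<rho>"
proof -
  obtain B where B: "0 \<le> B" "\<And>e x. x \<in> cball 0 \<rho> \<Longrightarrow>
      norm ((hqderiv q ^^ e) F x) \<le> B * (2 / ((1 - q) * \<rho>)) ^ e"
    using funpow_hqderiv_bound[OF q F \<rho>] by blast
  have lim: "uniform_limit (cball 0 \<rho>) (\<lambda>n x. \<Sum>e<n. c e * (hqderiv q ^^ e) F x)
      (\<lambda>x. \<Sum>e. c e * (hqderiv q ^^ e) F x) sequentially"
  proof (rule Weierstrass_m_test)
    show "summable (\<lambda>e. B * (norm (c e) * (2 / ((1 - q) * \<rho>)) ^ e))"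
      by (intro summable_mult c)
    show "norm (c e * (hqderiv q ^^ e) F x) \<le> B * (norm (c e) * (2 / ((1 - q) * \<rho>)) ^ e)"
      if "x \<in> cball 0 \<rho>" for e x
      using mult_left_mono[OF B(2)[OF that, of e] norm_ge_zero[of "c e"]] by (simp add: norm_mult mult_ac)
  qed
  show ?thesis
  proof (rule holomorphic_uniform_sequence)
    show "(\<lambda>x. \<Sum>e<n. c e * (hqderiv q ^^ e) F x) holomorphic_on ball 0 \<rho>" for n
      using \<rho> by (intro holomorphic_intros holomorphic_on_subset[OF funpow_hqderiv_holomorphic[OF q F]]) auto
    fix x :: complex assume "x \<in> ball 0 \<rho>"
    then obtain d where d: "0 < d" "cball x d \<subseteq> ball 0 \<rho>"
      using open_contains_cball[of "ball 0 \<rho>"] open_ball by blast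
    moreover have "cball x d \<subseteq> cball 0 \<rho>"
      using d(2) ball_subset_cball by blast
    ultimately show "\<exists>d>0. cball x d \<subseteq> ball 0 \<rho> \<and>
        uniform_limit (cball x d) (\<lambda>n x. \<Sum>e<n. c e * (hqderiv q ^^ e) F x)
          (\<lambda>x. \<Sum>e. c e * (hqderiv q ^^ e) F x) sequentially"
      using uniform_limit_on_subset[OF lim] by blast
  qed simp
qed

lemma holomorphic_eq_at_centre:
  assumes "F holomorphic_on ball 0 r" "G holomorphic_on ball 0 r" "0 < r"
    and "\<And>x. x \<in> ball 0 r \<Longrightarrow> x \<noteq> 0 \<Longrightarrow> F x = G x"
  shows "F 0 = G 0"
proof -
  have "isCont F 0" "isCont G 0"
    using assms by (auto intro!: continuous_on_interior[OF holomorphic_on_imp_continuous_on])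
  then have F: "F \<midarrow>0\<rightarrow> F 0" and G: "G \<midarrow>0\<rightarrow> G 0" by (auto simp: isCont_def)
  have "eventually (\<lambda>x. F x = G x) (at 0)"
    unfolding eventually_at using assms(3,4) by (intro exI[of _ r]) (auto simp: dist_commute)
  from LIM_unique[OF Lim_transform_eventually[OF F this] G] show ?thesis .
qed

text \<open>At 0 the termwise argument breaks down. Instead, both sides are represented by
  holomorphic functions on a small disk; these agree off 0 by the nonzero case and hence at 0 by
  continuity.\<close>

lemma funpow_qderiv_qconv:
  assumes q: "0 < q" "q < 1" and g: "g \<in> I_omega q \<gamma>" and h: "qexp_bounded q h x"
  shows "(qderiv q ^^ e) (qconv q \<gamma> g h) x = qconv q \<gamma> g ((qderiv q ^^ e) h) x"
proof (cases "x = 0")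
  case False
  then show ?thesis using funpow_qderiv_qconv_nonzero[OF q g h] by simp
next
  case True
  \<comment> \<open>By its definition the q-derivative exists at 0 only for functions analytic
    there, so the domain condition in \<open>qexp_bounded\<close> already yields a disk of
    holomorphy.\<close>
  have "0 \<in> dom ((qderiv q ^^ 1) h)"
    using h unfolding qexp_bounded_def True by blast
  then have "pfun_analytic_on h {0}"
    by (auto simp: qderiv_def Let_def split: if_splits)
  then obtain U where U: "open U" "0 \<in> U" "U \<subseteq> dom h" "(\<lambda>x. the (h x)) holomorphic_on U"
    by (auto simp: pfun_analytic_on_def)
  then obtain r where r: "0 < r" "ball 0 r \<subseteq> U"
    using openE by blast
  define F where "F = (\<lambda>x. the (h x))"
  have F: "F holomorphic_on ball 0 r"
    unfolding F_def using U r by (blast intro: holomorphic_on_subset)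
  have hF: "h x = Some (F x)" if "x \<in> ball 0 r" for x
    using that U(3) r(2) unfolding F_def by force
  define \<rho> where "\<rho> = r / 2"
  have \<rho>: "0 < \<rho>" "\<rho> < r" using r by (auto simp: \<rho>_def)
  \<comment> \<open>\<open>T G\<close> is the holomorphic representative of the convolution of
    \<open>g\<close> with a function represented by \<open>G\<close>.\<close>
  define T where "T = (\<lambda>G x. \<Sum>e. qcoeff q \<gamma> g e * (hqderiv q ^^ e) G x)"
  have T_hol: "T G holomorphic_on ball 0 \<rho>" if "G holomorphic_on ball 0 r" for G
    unfolding T_def
    by (rule suminf_hqderiv_holomorphic[OF q that \<rho> I_omega_summable[OF q g]])
  have T: "qconv q \<gamma> g k x = Some (T G x)"
    if "G holomorphic_on ball 0 r" "\<And>x. x \<in> ball 0 r \<Longrightarrow> k x = Some (G x)" "x \<in> ball 0 \<rho>" for k G x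
  proof -
    have x: "x \<in> ball 0 r" using that(3) \<rho> by simp
    have "(qderiv q ^^ e) k x = Some ((hqderiv q ^^ e) G x)" for e
      by (rule funpow_qderiv_ball[OF q that(1,2) x])
    then show ?thesis
      using qconv_exp_bounded(1)[OF q g qexp_bounded_ball[OF q that(1,2) x]] by (simp add: T_def)
  qed
  have L: "(qderiv q ^^ e) (qconv q \<gamma> g h) x = Some ((hqderiv q ^^ e) (T F) x)"
    if "x \<in> ball 0 \<rho>" for x
  proof (rule funpow_qderiv_ball[OF q T_hol[OF F] _ that])
    show "qconv q \<gamma> g h y = Some (T F y)" if "y \<in> ball 0 \<rho>" for y
      by (rule T[OF F _ that]) (rule hF)
  qed
  have R: "qconv q \<gamma> g ((qderiv q ^^ e) h) x = Some (T ((hqderiv q ^^ e) F) x)"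
    if "x \<in> ball 0 \<rho>" for x
  proof (rule T[OF funpow_hqderiv_holomorphic[OF q F] _ that])
    show "(qderiv q ^^ e) h y = Some ((hqderiv q ^^ e) F y)" if "y \<in> ball 0 r" for y
      by (rule funpow_qderiv_ball[OF q F _ that]) (rule hF)
  qed
  have "(hqderiv q ^^ e) (T F) 0 = T ((hqderiv q ^^ e) F) 0"
  proof (rule holomorphic_eq_at_centre[OF _ _ \<rho>(1)])
    fix x :: complex assume x: "x \<in> ball 0 \<rho>" "x \<noteq> 0"
    then have "qexp_bounded q h x"
      by (intro qexp_bounded_ball[OF q F hF]) (use \<rho> in auto)
    from funpow_qderiv_qconv_nonzero[OF q g this x(2), of e]
    show "(hqderiv q ^^ e) (T F) x = T ((hqderiv q ^^ e) F) x"
      using L[OF x(1)] R[OF x(1)] by simp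
  qed (intro funpow_hqderiv_holomorphic[OF q] T_hol F)+
  then show ?thesis using \<rho> L[of 0] R[of 0] by (simp add: True)
qed

section \<open>Rearranging double series over pairs of orders, and formal associativity\<close>

lemma summable_on_nat_Times:
  fixes a b H :: "nat \<Rightarrow> complex"
  assumes a: "\<And>R::real. summable (\<lambda>e. norm (a e) * R ^ e)"
    and b: "\<And>R::real. summable (\<lambda>e. norm (b e) * R ^ e)"
    and H: "\<And>e. norm (H e) \<le> C * R ^ e" and R: "0 < R"
  shows "(\<lambda>(e, d). a e * b d * H (e + d)) summable_on UNIV \<times> UNIV"
proof (rule Infinite_Sum.abs_summable_summable, rule Infinite_Sum.abs_summable_on_comparison_test'[where
    g = "\<lambda>(e, d). C * ((norm (a e) * R ^ e) * (norm (b d) * R ^ d))"])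
  define B where "B = (\<Sum>e. norm (b e) * R ^ e)"
  have hs: "((\<lambda>e. norm (c e) * R ^ e) has_sum (\<Sum>e. norm (c e) * R ^ e)) UNIV"
    if "\<And>R::real. summable (\<lambda>e. norm (c e) * R ^ e)" for c :: "nat \<Rightarrow> complex"
    using that[of R] R by (intro norm_summable_imp_has_sum summable_sums) (simp_all add: norm_mult norm_power)
  have C: "0 \<le> C" using order_trans[OF norm_ge_zero H[of 0]] by simp
  show "(\<lambda>(e, d). C * ((norm (a e) * R ^ e) * (norm (b d) * R ^ d))) summable_on UNIV \<times> UNIV"
  proof (rule summable_on_SigmaI)
    show "((\<lambda>d. case (e, d) of (e, d) \<Rightarrow> C * ((norm (a e) * R ^ e) * (norm (b d) * R ^ d))) has_sum
        C * ((norm (a e) * R ^ e) * B)) UNIV" for e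
      using hs[OF b] by (auto intro!: has_sum_cmult_right simp: B_def)
    show "(\<lambda>e. C * ((norm (a e) * R ^ e) * B)) summable_on UNIV"
      using hs[OF a] by (intro summable_on_cmult_right summable_on_cmult_left) (auto simp: summable_on_def)
  qed (use C R in auto)
  show "norm (case x of (e, d) \<Rightarrow> a e * b d * H (e + d)) \<le>
      (case x of (e, d) \<Rightarrow> C * ((norm (a e) * R ^ e) * (norm (b d) * R ^ d)))" for x
  proof (cases x)
    case (Pair e d)
    \<comment> \<open>Because R^(e + d) = R^e R^d, the majorant is a product of two separately
      summable sequences.\<close>
    have "norm (a e * b d) * norm (H (e + d)) \<le> norm (a e * b d) * (C * R ^ (e + d))"
      by (intro mult_left_mono H) simp
    then show ?thesis by (simp add: Pair norm_mult power_add mult_ac)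
  qed
qed

text \<open>Both sides sum one absolutely convergent double family, by antidiagonals on the left and
  by rows on the right; (e, d) \<mapsto> (e + d, e) is the bijection between the two index
  sets.\<close>

lemma suminf_antidiagonal:
  fixes a b H :: "nat \<Rightarrow> complex"
  assumes a: "\<And>R::real. summable (\<lambda>e. norm (a e) * R ^ e)"
    and b: "\<And>R::real. summable (\<lambda>e. norm (b e) * R ^ e)"
    and H: "\<And>e. norm (H e) \<le> C * R ^ e" and R: "0 < R"
  shows "(\<Sum>m. (\<Sum>e\<le>m. a e * b (m - e)) * H m) = (\<Sum>e. a e * (\<Sum>d. b d * H (e + d)))"
proof -
  define P where "P = (\<lambda>(e, d). a e * b d * H (e + d))"
  obtain S where S: "(P has_sum S) (UNIV \<times> UNIV)"
    using summable_on_nat_Times[OF assms] by (auto simp: summable_on_def P_def)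
  have "((\<lambda>e. a e * (\<Sum>d. b d * H (e + d))) has_sum S) UNIV"
  proof (rule has_sum_SigmaD[OF S])
    fix e
    have "summable (\<lambda>d. norm (b d * H (e + d)))"
      using H[of "e + _"] by (intro summable_exp_bounded[OF b, of _ "C * R ^ e" R]) (simp add: power_add mult_ac)
    then have "((\<lambda>d. b d * H (e + d)) has_sum (\<Sum>d. b d * H (e + d))) UNIV"
      by (intro norm_summable_imp_has_sum summable_sums) (auto intro: summable_norm_cancel)
    from has_sum_cmult_right[OF this, of "a e"]
    show "((\<lambda>d. P (e, d)) has_sum a e * (\<Sum>d. b d * H (e + d))) UNIV"
      by (simp add: P_def mult_ac)
  qed
  from has_sum_imp_sums[OF this] have rhs: "(\<Sum>e. a e * (\<Sum>d. b d * H (e + d))) = S"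
    by (rule sums_unique[symmetric])
  have "((\<lambda>(m, e). a e * b (m - e) * H m) has_sum S) (SIGMA m:UNIV. {..m}) \<longleftrightarrow>
      (P has_sum S) (UNIV \<times> UNIV)"
    by (rule has_sum_reindex_bij_witness[of _ "\<lambda>(e, d). (e + d, e)" "\<lambda>(m, e). (e, m - e)"])
      (auto simp: P_def)
  with S have S': "((\<lambda>(m, e). a e * b (m - e) * H m) has_sum S) (SIGMA m:UNIV. {..m})"
    by blast
  have "((\<lambda>m. \<Sum>e\<le>m. a e * b (m - e) * H m) has_sum S) UNIV"
    by (rule has_sum_SigmaD[OF S']) (simp add: has_sum_finite)
  from has_sum_imp_sums[OF this] have "(\<lambda>m. (\<Sum>e\<le>m. a e * b (m - e)) * H m) sums S"
    unfolding sum_distrib_right .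
  from sums_unique[OF this] show ?thesis by (simp only: rhs)
qed

text \<open>Writing R^m = R^e R^(m - e) makes the weighted sequence a Cauchy product of weighted
  sequences. For the convolution of f and g this takes the place of a decay estimate for its
  moments.\<close>

lemma summable_Cauchy_coeff:
  fixes a b :: "nat \<Rightarrow> complex"
  assumes a: "\<And>R::real. summable (\<lambda>e. norm (a e) * R ^ e)"
    and b: "\<And>R::real. summable (\<lambda>e. norm (b e) * R ^ e)"
  shows "summable (\<lambda>m. norm (\<Sum>e\<le>m. a e * b (m - e)) * R ^ m)"
proof (rule summable_comparison_test')
  show "summable (\<lambda>m. \<Sum>e\<le>m. (norm (a e) * \<bar>R\<bar> ^ e) * (norm (b (m - e)) * \<bar>R\<bar> ^ (m - e)))"
    using a[of "\<bar>R\<bar>"] b[of "\<bar>R\<bar>"] by (intro summable_Cauchy_product) (simp_all add: abs_mult power_abs)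
  fix m
  have "norm (\<Sum>e\<le>m. a e * b (m - e)) * \<bar>R\<bar> ^ m \<le> (\<Sum>e\<le>m. norm (a e * b (m - e))) * \<bar>R\<bar> ^ m"
    by (intro mult_right_mono norm_sum) simp
  also have "\<dots> = (\<Sum>e\<le>m. (norm (a e) * \<bar>R\<bar> ^ e) * (norm (b (m - e)) * \<bar>R\<bar> ^ (m - e)))"
    unfolding sum_distrib_right
  proof (intro sum.cong refl)
    fix e assume "e \<in> {..m}"
    then have "\<bar>R\<bar> ^ m = \<bar>R\<bar> ^ e * \<bar>R\<bar> ^ (m - e)" by (simp flip: power_add)
    then show "norm (a e * b (m - e)) * \<bar>R\<bar> ^ m = (norm (a e) * \<bar>R\<bar> ^ e) * (norm (b (m - e)) * \<bar>R\<bar> ^ (m - e))"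
      by (simp add: norm_mult)
  qed
  finally show "norm (norm (\<Sum>e\<le>m. a e * b (m - e)) * R ^ m) \<le>
      (\<Sum>e\<le>m. (norm (a e) * \<bar>R\<bar> ^ e) * (norm (b (m - e)) * \<bar>R\<bar> ^ (m - e)))"
    by (simp add: abs_mult power_abs)
qed

text \<open>The bound C R^(d + e) splits off R^e, so the rate \<open>R\<close> survives convolution;
  the new constant is \<open>C\<close> times the weighted sum \<open>B\<close> of the
  coefficients.\<close>

lemma qexp_bounded_qconv:
  assumes q: "0 < q" "q < 1" and g: "g \<in> I_omega q \<gamma>" and h: "qexp_bounded q h x"
  shows "qexp_bounded q (qconv q \<gamma> g h) x"
proof -
  have D: "(qderiv q ^^ e) (qconv q \<gamma> g h) x =
      Some (\<Sum>d. qcoeff q \<gamma> g d * the ((qderiv q ^^ (d + e)) h x))" for e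
    using qconv_exp_bounded(1)[OF q g qexp_bounded_funpow[OF h]]
    by (simp add: funpow_qderiv_qconv[OF q g h] funpow_add)
  from h obtain R C where RC: "0 < R" "\<And>e. norm (the ((qderiv q ^^ e) h x)) \<le> C * R ^ e"
    by (auto simp: qexp_bounded_def)
  define B where "B = (\<Sum>d. norm (qcoeff q \<gamma> g d) * R ^ d)"
  show ?thesis
  proof (rule qexp_boundedI[OF _ RC(1)])
    fix e
    show "x \<in> dom ((qderiv q ^^ e) (qconv q \<gamma> g h))" by (simp add: D dom_def)
    have s: "summable (\<lambda>d. (C * R ^ e) * (norm (qcoeff q \<gamma> g d) * R ^ d))"
      by (intro summable_mult I_omega_summable[OF q g])
    have "norm (qcoeff q \<gamma> g d * the ((qderiv q ^^ (d + e)) h x)) \<le>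
        (C * R ^ e) * (norm (qcoeff q \<gamma> g d) * R ^ d)" for d
      using mult_left_mono[OF RC(2)[of "d + e"] norm_ge_zero[of "qcoeff q \<gamma> g d"]]
      by (simp add: norm_mult power_add mult_ac)
    from norm_suminf_le[OF this s] suminf_mult[OF I_omega_summable[OF q g], of "C * R ^ e" R]
    show "norm (the ((qderiv q ^^ e) (qconv q \<gamma> g h) x)) \<le> (C * B) * R ^ e"
      by (simp add: D B_def mult_ac)
  qed
qed

text \<open>The formal half of the theorem. The assumptions \<open>fg\<close> and
  \<open>coeff\<close> are what integration over the lattice has to deliver.\<close>

lemma qconv_assoc:
  assumes q: "0 < q" "q < 1" and f: "f \<in> I_omega q \<gamma>" and g: "g \<in> I_omega q \<gamma>'"
    and fg: "qconv q \<gamma> f g \<in> I_inf q \<gamma>'"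
    and coeff: "\<And>m. qcoeff q \<gamma>' (qconv q \<gamma> f g) m = (\<Sum>e\<le>m. qcoeff q \<gamma> f e * qcoeff q \<gamma>' g (m - e))"
    and h: "qexp_bounded q h x"
  shows "eq_at (qconv q \<gamma>' (qconv q \<gamma> f g) h) (qconv q \<gamma> f (qconv q \<gamma>' g h)) x"
proof -
  let ?H = "\<lambda>e. the ((qderiv q ^^ e) h x)"
  note sf = I_omega_summable[OF q f] and sg = I_omega_summable[OF q g]
  from h obtain R C where RC: "0 < R" "\<And>e. norm (?H e) \<le> C * R ^ e"
    by (auto simp: qexp_bounded_def)
  have "the ((qderiv q ^^ e) (qconv q \<gamma>' g h) x) = (\<Sum>d. qcoeff q \<gamma>' g d * ?H (e + d))" for e
    using qconv_exp_bounded(1)[OF q g qexp_bounded_funpow[OF h]]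
    by (simp add: funpow_qderiv_qconv[OF q g h] funpow_qderiv_shift add.commute)
  then have "qconv q \<gamma> f (qconv q \<gamma>' g h) x =
      Some (\<Sum>e. qcoeff q \<gamma> f e * (\<Sum>d. qcoeff q \<gamma>' g d * ?H (e + d)))"
    using qconv_exp_bounded(1)[OF q f qexp_bounded_qconv[OF q g h]] by simp
  moreover have "qconv q \<gamma>' (qconv q \<gamma> f g) h x =
      Some (\<Sum>m. qcoeff q \<gamma>' (qconv q \<gamma> f g) m * ?H m)"
  proof (rule qconv_eq[OF _ fg])
    show "summable (\<lambda>m. norm (qcoeff q \<gamma>' (qconv q \<gamma> f g) m * ?H m))"
      unfolding coeff by (rule summable_exp_bounded[OF summable_Cauchy_coeff[OF sf sg] RC(2)])
  qed (use h in \<open>auto simp: qexp_bounded_def\<close>)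
  ultimately show ?thesis
    using suminf_antidiagonal[OF sf sg RC(2,1)] by (simp add: eq_at_def coeff)
qed

subsection \<open>Integration over the q-lattice\<close>

abbreviation qindex :: "(int \<times> real) set" where
  "qindex \<equiv> UNIV \<times> {1, -1}"

definition qpoint :: "real \<Rightarrow> real \<Rightarrow> int \<times> real \<Rightarrow> complex" where
  "qpoint q \<gamma> = (\<lambda>(k, \<epsilon>). of_real (\<epsilon> * q powi k * \<gamma>))"

lemma qint_term_eq: "qint_term q \<gamma> F p = of_real (q powi fst p * \<gamma>) * F (qpoint q \<gamma> p)"
  by (simp add: qint_term_def qpoint_def split: prod.split)

lemma qpoint_in_qlattice: "p \<in> qindex \<Longrightarrow> qpoint q \<gamma> p \<in> qlattice q \<gamma>"
  by (cases p) (auto simp: qpoint_def qlattice_def)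

lemma qlattice_nonzero: "0 < q \<Longrightarrow> 0 < \<gamma> \<Longrightarrow> x \<in> qlattice q \<gamma> \<Longrightarrow> x \<noteq> 0"
  by (auto simp: qlattice_def)

lemma qpoint_Suc: "0 < q \<Longrightarrow> qpoint q \<gamma> (k + 1, \<epsilon>) = of_real q * qpoint q \<gamma> (k, \<epsilon>)"
  by (simp add: qpoint_def power_int_add mult_ac)

lemma qlattice_scale:
  assumes "0 < q" "x \<in> qlattice q \<gamma>" shows "of_real q * x \<in> qlattice q \<gamma>"
proof -
  from assms obtain p where "x = qpoint q \<gamma> p" "p \<in> qindex"
    by (auto simp: qlattice_def qpoint_def)
  then show ?thesis
    using assms(1) qpoint_in_qlattice[of "(fst p + 1, snd p)" q \<gamma>] qpoint_Suc[of q \<gamma> "fst p" "snd p"]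
    by (cases p) auto
qed

lemma norm_qpoint:
  "0 < q \<Longrightarrow> 0 < \<gamma> \<Longrightarrow> p \<in> qindex \<Longrightarrow> norm (qpoint q \<gamma> p) = q powi fst p * \<gamma>"
  by (auto simp: qpoint_def norm_mult abs_mult simp del: of_real_mult of_real_power_int)

lemma qint_term_cong:
  "(\<And>x. x \<in> qlattice q \<gamma> \<Longrightarrow> F x = G x) \<Longrightarrow> p \<in> qindex \<Longrightarrow> qint_term q \<gamma> F p = qint_term q \<gamma> G p"
  by (simp add: qint_term_eq qpoint_in_qlattice del: mem_Sigma_iff)

lemma qintegral_cong:
  "(\<And>x. x \<in> qlattice q \<gamma> \<Longrightarrow> F x = G x) \<Longrightarrow> qintegral q \<gamma> F = qintegral q \<gamma> G"
  unfolding qintegral_def by (intro arg_cong2[where f = "(*)"] infsum_cong qint_term_cong) auto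

lemma qintegrable_has_sum:
  "qintegrable q \<gamma> F \<Longrightarrow> (qint_term q \<gamma> F has_sum (\<Sum>\<^sub>\<infinity>p\<in>qindex. qint_term q \<gamma> F p)) qindex"
  by (simp add: qintegrable_def Infinite_Sum.abs_summable_summable)

lemma bij_betw_qindex_shift: "bij_betw (\<lambda>(k, \<epsilon>). (k + 1, \<epsilon>)) qindex qindex"
  by (rule bij_betwI[of _ _ _ "\<lambda>(k, \<epsilon>). (k - 1, \<epsilon>)"]) auto

lemma qint_term_scale:
  assumes "0 < q"
  shows "qint_term q \<gamma> (\<lambda>x. F (of_real q * x)) p = qint_term q \<gamma> F (case p of (k, \<epsilon>) \<Rightarrow> (k + 1, \<epsilon>)) / of_real q"
  using assms by (cases p) (simp add: qint_term_eq qpoint_Suc power_int_add)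

text \<open>Replacing x by q x shifts the lattice index by one, a bijection of the index set, while
  the weight falls one factor q behind; hence the quotient by q.\<close>

lemma qintegrable_scale:
  assumes "0 < q" "qintegrable q \<gamma> F"
  shows "qintegrable q \<gamma> (\<lambda>x. F (of_real q * x))"
    and "qintegral q \<gamma> (\<lambda>x. F (of_real q * x)) = qintegral q \<gamma> F / of_real q"
    and "(\<Sum>\<^sub>\<infinity>p\<in>qindex. norm (qint_term q \<gamma> (\<lambda>x. F (of_real q * x)) p)) =
      (\<Sum>\<^sub>\<infinity>p\<in>qindex. norm (qint_term q \<gamma> F p)) / q"
proof -
  have n: "norm (qint_term q \<gamma> (\<lambda>x. F (of_real q * x)) p) =
      norm (qint_term q \<gamma> F (case p of (k, \<epsilon>) \<Rightarrow> (k + 1, \<epsilon>))) * (1 / q)" for p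
    using assms(1) by (simp add: qint_term_scale norm_divide)
  show "qintegrable q \<gamma> (\<lambda>x. F (of_real q * x))"
    using assms(2) summable_on_reindex_bij_betw[OF bij_betw_qindex_shift, of "\<lambda>p. norm (qint_term q \<gamma> F p)"]
    unfolding qintegrable_def n by (intro summable_on_cmult_left) blast
  show "(\<Sum>\<^sub>\<infinity>p\<in>qindex. norm (qint_term q \<gamma> (\<lambda>x. F (of_real q * x)) p)) =
      (\<Sum>\<^sub>\<infinity>p\<in>qindex. norm (qint_term q \<gamma> F p)) / q"
    unfolding n infsum_cmult_left'
    by (simp add: infsum_reindex_bij_betw[OF bij_betw_qindex_shift, of "\<lambda>p. norm (qint_term q \<gamma> F p)"])
  have "(\<Sum>\<^sub>\<infinity>p\<in>qindex. qint_term q \<gamma> (\<lambda>x. F (of_real q * x)) p) =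
      (\<Sum>\<^sub>\<infinity>p\<in>qindex. qint_term q \<gamma> F (case p of (k, \<epsilon>) \<Rightarrow> (k + 1, \<epsilon>)) * (1 / of_real q))"
    using assms(1) by (simp add: qint_term_scale)
  then show "qintegral q \<gamma> (\<lambda>x. F (of_real q * x)) = qintegral q \<gamma> F / of_real q"
    unfolding qintegral_def infsum_cmult_left'
    by (simp add: infsum_reindex_bij_betw[OF bij_betw_qindex_shift, of "qint_term q \<gamma> F"])
qed

lemma qintegral_lincomb:
  assumes "qintegrable q \<gamma> F" "qintegrable q \<gamma> G"
  shows "qintegral q \<gamma> (\<lambda>x. a * F x + b * G x) = a * qintegral q \<gamma> F + b * qintegral q \<gamma> G"
proof -
  have "((\<lambda>p. a * qint_term q \<gamma> F p + b * qint_term q \<gamma> G p) has_sum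
      (a * (\<Sum>\<^sub>\<infinity>p\<in>qindex. qint_term q \<gamma> F p) + b * (\<Sum>\<^sub>\<infinity>p\<in>qindex. qint_term q \<gamma> G p))) qindex"
    by (intro has_sum_add has_sum_cmult_right qintegrable_has_sum assms)
  moreover have "(\<lambda>p. a * qint_term q \<gamma> F p + b * qint_term q \<gamma> G p) = qint_term q \<gamma> (\<lambda>x. a * F x + b * G x)"
    by (auto simp: fun_eq_iff qint_term_eq algebra_simps)
  ultimately have "(\<Sum>\<^sub>\<infinity>p\<in>qindex. qint_term q \<gamma> (\<lambda>x. a * F x + b * G x) p) =
      a * (\<Sum>\<^sub>\<infinity>p\<in>qindex. qint_term q \<gamma> F p) + b * (\<Sum>\<^sub>\<infinity>p\<in>qindex. qint_term q \<gamma> G p)"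
    by (simp add: infsumI)
  then show ?thesis by (simp add: qintegral_def algebra_simps)
qed

lemma qderiv_qlattice:
  assumes "0 < q" "0 < \<gamma>" "qlattice q \<gamma> \<subseteq> dom G" "x \<in> qlattice q \<gamma>"
  shows "qderiv q G x = Some ((the (G x) - the (G (of_real q * x))) / (of_real (1 - q) * x))"
  using assms qlattice_nonzero[OF assms(1,2,4)] qlattice_scale[OF assms(1,4)]
  by (intro qderiv_nonzero) blast+

text \<open>One power of x cancels the denominator of the difference quotient, so the integrand
  splits into two integrable parts, the second a rescaling of the first. No boundary term appears;
  it can arise only for the exponent 0.\<close>

lemma qintegral_qderiv_Suc:
  assumes q: "0 < q" "q < 1" and \<gamma>: "0 < \<gamma>" and G: "G \<in> I_inf q \<gamma>"
  shows "qintegral q \<gamma> (\<lambda>x. the (qderiv q G x) * x ^ Suc m) =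
    - of_real (qnum q (Suc m) / q ^ Suc m) * qintegral q \<gamma> (\<lambda>x. the (G x) * x ^ m)"
proof -
  let ?F = "\<lambda>x. the (G x) * x ^ m"
  have F: "qintegrable q \<gamma> ?F" using G by (simp add: I_inf_def)
  have "the (qderiv q G x) * x ^ Suc m =
      (1 / of_real (1 - q)) * ?F x + (- 1 / (of_real (1 - q) * of_real q ^ m)) * ?F (of_real q * x)"
    if "x \<in> qlattice q \<gamma>" for x
  proof -
    have "x \<noteq> 0" "complex_of_real (1 - q) \<noteq> 0" "complex_of_real q \<noteq> 0"
      using that q \<gamma> qlattice_nonzero by auto
    then show ?thesis
      using qderiv_qlattice[OF q(1) \<gamma> _ that, of G] G
      by (simp add: I_inf_def power_mult_distrib divide_simps del: of_real_diff) (simp add: algebra_simps)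
  qed
  from qintegral_cong[OF this]
  have "qintegral q \<gamma> (\<lambda>x. the (qderiv q G x) * x ^ Suc m) = qintegral q \<gamma> (\<lambda>x.
      (1 / of_real (1 - q)) * ?F x + (- 1 / (of_real (1 - q) * of_real q ^ m)) * ?F (of_real q * x))" .
  also have "\<dots> = (1 / of_real (1 - q)) * qintegral q \<gamma> ?F +
      (- 1 / (of_real (1 - q) * of_real q ^ m)) * (qintegral q \<gamma> ?F / of_real q)"
    by (simp only: qintegral_lincomb[OF F qintegrable_scale(1)[OF q(1) F]] qintegrable_scale(2)[OF q(1) F])
  also have "\<dots> = - of_real (qnum q (Suc m) / q ^ Suc m) * qintegral q \<gamma> ?F"
  proof -
    have "complex_of_real (1 - q) \<noteq> 0" "complex_of_real q \<noteq> 0" using q by auto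
    then show ?thesis
      unfolding qnum_def
      by (simp add: divide_simps del: of_real_diff) (simp add: algebra_simps)
  qed
  finally show ?thesis .
qed

section \<open>Vanishing of the q-integral of a q-derivative\<close>

lemma filterlim_symmetric_qindex:
  "filterlim (\<lambda>n. {- int n..<int n} \<times> {1, -1 :: real}) (finite_subsets_at_top qindex) sequentially"
  unfolding filterlim_def le_filter_def eventually_filtermap
proof (intro allI impI)
  fix P :: "(int \<times> real) set \<Rightarrow> bool"
  assume "eventually P (finite_subsets_at_top qindex)"
  from this[unfolded eventually_finite_subsets_at_top] obtain X where X: "finite X" "X \<subseteq> qindex"
    "\<And>Y. finite Y \<and> X \<subseteq> Y \<and> Y \<subseteq> qindex \<Longrightarrow> P Y"
    by (elim exE conjE) (rule that, auto)
  have "eventually (\<lambda>n. \<forall>p\<in>X. p \<in> {- int n..<int n} \<times> {1, -1}) sequentially"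
  proof (rule eventually_ball_finite[OF X(1)], rule ballI)
    fix p assume "p \<in> X"
    then have "snd p \<in> {1, -1}" using X(2) by auto
    moreover have "- int n \<le> fst p \<and> fst p < int n" if "nat \<bar>fst p\<bar> + 1 \<le> n" for n
      using that by linarith
    ultimately show "eventually (\<lambda>n. p \<in> {- int n..<int n} \<times> {1, -1}) sequentially"
      by (intro eventually_sequentiallyI[of "nat \<bar>fst p\<bar> + 1"]) (simp add: mem_Times_iff)
  qed
  then show "eventually (\<lambda>n. P ({- int n..<int n} \<times> {1, -1})) sequentially"
  proof (rule eventually_mono)
    fix n assume "\<forall>p\<in>X. p \<in> {- int n..<int n} \<times> {1, -1}"
    then have "X \<subseteq> {- int n..<int n} \<times> {1, -1}" by (intro subsetI) (rule bspec)
    then show "P ({- int n..<int n} \<times> {1, -1})" by (intro X(3) conjI Sigma_mono finite_SigmaI) auto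
  qed
qed

lemma sum_int_telescope:
  fixes u :: "int \<Rightarrow> complex"
  shows "(\<Sum>k\<in>{- int n..<int n}. u k - u (k + 1)) = u (- int n) - u (int n)"
proof (induction n)
  case (Suc n)
  have "{- int (Suc n)..<int (Suc n)} = insert (- int n - 1) (insert (int n) {- int n..<int n})"
    by auto
  then have "(\<Sum>k\<in>{- int (Suc n)..<int (Suc n)}. u k - u (k + 1)) =
      (u (- int n - 1) - u (- int n)) + ((u (int n) - u (int n + 1)) + (u (- int n) - u (int n)))"
    using Suc by simp
  also have "\<dots> = u (- int n - 1) - u (int n + 1)" by simp
  also have "\<dots> = u (- int (Suc n)) - u (int (Suc n))"
    by (intro arg_cong2[where f = "(-)"] arg_cong[where f = u]) auto
  finally show ?case .
qed simp

lemma qpoint_tendsto_0: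
  assumes "0 < q" "q < 1"
  shows "(\<lambda>n. qpoint q \<gamma> (int n, \<epsilon>)) \<longlonglongrightarrow> 0"
proof -
  have "(\<lambda>n. \<epsilon> * q ^ n * \<gamma>) \<longlonglongrightarrow> 0"
    using assms by (intro tendsto_mult_left_zero tendsto_mult_right_zero LIMSEQ_power_zero) auto
  from tendsto_of_real[OF this, where 'a = complex] show ?thesis
    by (simp add: qpoint_def)
qed

lemma HD_tendsto_at_0:
  assumes q: "0 < q" "q < 1" and \<gamma>: "0 < \<gamma>" and G: "G \<in> HD q \<gamma> A"
  obtains L where "\<And>\<epsilon>. \<epsilon> \<in> {1, -1} \<Longrightarrow> (\<lambda>n. the (G (qpoint q \<gamma> (int n, \<epsilon>)))) \<longlonglongrightarrow> L"
proof -
  from G obtain r F where r: "0 < r" and F: "F holomorphic_on ball 0 r"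
    and eq: "\<And>x. x \<in> qlattice q \<gamma> \<Longrightarrow> x \<in> ball 0 r \<Longrightarrow> G x = Some (F x)"
    by (auto simp: HD_def)
  have "isCont F 0"
    using F r by (auto intro!: continuous_on_interior[OF holomorphic_on_imp_continuous_on])
  show ?thesis
  proof (rule that)
    fix \<epsilon> :: real assume \<epsilon>: "\<epsilon> \<in> {1, -1}"
    let ?p = "\<lambda>n. qpoint q \<gamma> (int n, \<epsilon>)"
    have p: "?p \<longlonglongrightarrow> 0" by (rule qpoint_tendsto_0[OF q])
    then have "eventually (\<lambda>n. ?p n \<in> ball 0 r) sequentially"
      by (rule topological_tendstoD) (use r in auto)
    then have "eventually (\<lambda>n. F (?p n) = the (G (?p n))) sequentially"
      by eventually_elim (use \<epsilon> in \<open>simp add: eq qpoint_in_qlattice\<close>)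
    moreover have "(\<lambda>n. F (?p n)) \<longlonglongrightarrow> F 0"
      by (rule isCont_tendsto_compose[OF \<open>isCont F 0\<close> p])
    ultimately show "(\<lambda>n. the (G (?p n))) \<longlonglongrightarrow> F 0"
      by (rule Lim_transform_eventually[rotated])
  qed
qed

text \<open>Towards infinity the weights q^(-n) \<gamma> are at least \<gamma>, so summability of
  the weighted values forces the values themselves to 0.\<close>

lemma qintegrable_tendsto_0:
  assumes q: "0 < q" "q < 1" and \<gamma>: "0 < \<gamma>" and F: "qintegrable q \<gamma> F" and \<epsilon>: "\<epsilon> \<in> {1, -1}"
  shows "(\<lambda>n. F (qpoint q \<gamma> (- int n, \<epsilon>))) \<longlonglongrightarrow> 0"
proof -
  have "(\<lambda>p. norm (qint_term q \<gamma> F p)) summable_on range (\<lambda>n. (- int n, \<epsilon>))"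
    using F unfolding qintegrable_def by (rule summable_on_subset_banach) (use \<epsilon> in auto)
  then have "((\<lambda>p. norm (qint_term q \<gamma> F p)) \<circ> (\<lambda>n. (- int n, \<epsilon>))) summable_on UNIV"
    by (subst (asm) summable_on_reindex) (auto simp: inj_on_def)
  then have "summable (\<lambda>n. norm (qint_term q \<gamma> F (- int n, \<epsilon>)))"
    by (auto dest: summable_on_imp_summable simp: o_def)
  then have lim: "(\<lambda>n. norm (qint_term q \<gamma> F (- int n, \<epsilon>)) / \<gamma>) \<longlonglongrightarrow> 0"
    by (intro tendsto_divide_zero summable_LIMSEQ_zero)
  show ?thesis
  proof (rule Lim_null_comparison[OF always_eventually lim], rule allI)
    fix n
    have "1 \<le> q powi (- int n)"
      using q by (simp add: power_int_minus one_le_inverse power_le_one)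
    then have "1 * norm (F (qpoint q \<gamma> (- int n, \<epsilon>))) \<le>
        q powi (- int n) * norm (F (qpoint q \<gamma> (- int n, \<epsilon>)))"
      by (intro mult_right_mono) auto
    then show "norm (F (qpoint q \<gamma> (- int n, \<epsilon>))) \<le> norm (qint_term q \<gamma> F (- int n, \<epsilon>)) / \<gamma>"
      using q \<gamma> by (simp add: qint_term_eq norm_mult abs_mult del: of_real_mult of_real_power_int)
  qed
qed

text \<open>The integral telescopes. Its two ends cancel: at infinity by integrability, and at \<open>0\<close>
  because \<open>G\<close> has the same limit along both halves of the lattice.\<close>

lemma qintegral_qderiv_0:
  assumes q: "0 < q" "q < 1" and \<gamma>: "0 < \<gamma>" and G: "G \<in> HD q \<gamma> (I_inf q \<gamma>)"
    and D: "qintegrable q \<gamma> (\<lambda>x. the (qderiv q G x))"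
  shows "qintegral q \<gamma> (\<lambda>x. the (qderiv q G x)) = 0"
proof -
  have G': "qlattice q \<gamma> \<subseteq> dom G" "\<And>e. qintegrable q \<gamma> (\<lambda>x. the (G x) * x ^ e)"
    using G by (auto simp: HD_def I_inf_def)
  define u where "u = (\<lambda>\<epsilon> k. the (G (qpoint q \<gamma> (k, \<epsilon>))))"
  let ?t = "qint_term q \<gamma> (\<lambda>x. the (qderiv q G x))"
  \<comment> \<open>The weight is |x| but the denominator contains x, so the sign \<epsilon>
    survives and the two halves of the lattice telescope with opposite signs.\<close>
  have t: "?t (k, \<epsilon>) = of_real (\<epsilon> / (1 - q)) * (u \<epsilon> k - u \<epsilon> (k + 1))" if \<epsilon>: "\<epsilon> \<in> {1, -1}" for k \<epsilon>
  proof -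
    have x: "qpoint q \<gamma> (k, \<epsilon>) \<in> qlattice q \<gamma>" using \<epsilon> by (simp add: qpoint_in_qlattice)
    have w: "q powi k * \<gamma> \<noteq> 0" using q \<gamma> by simp
    have "?t (k, \<epsilon>) = of_real (q powi k * \<gamma>) * ((u \<epsilon> k - u \<epsilon> (k + 1)) /
        (of_real (1 - q) * of_real (\<epsilon> * (q powi k * \<gamma>))))"
      using qderiv_qlattice[OF q(1) \<gamma> G'(1) x] q(1)
      by (simp add: qint_term_eq u_def qpoint_Suc) (simp add: qpoint_def mult_ac)
    also have "\<dots> = of_real (\<epsilon> / (1 - q)) * (u \<epsilon> k - u \<epsilon> (k + 1))"
      using w q \<epsilon> by (auto simp: divide_simps)
    finally show ?thesis .
  qed
  obtain L where L: "\<And>\<epsilon>. \<epsilon> \<in> {1, -1} \<Longrightarrow> (\<lambda>n. u \<epsilon> (int n)) \<longlonglongrightarrow> L"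
    using HD_tendsto_at_0[OF q \<gamma> G] unfolding u_def by blast
  have N: "(\<lambda>n. u \<epsilon> (- int n)) \<longlonglongrightarrow> 0" if "\<epsilon> \<in> {1, -1}" for \<epsilon>
    unfolding u_def using qintegrable_tendsto_0[OF q \<gamma> G'(2)[of 0] that] by simp
  have sum_t: "(\<Sum>p\<in>{- int n..<int n} \<times> {1, -1}. ?t p) =
      of_real (1 / (1 - q)) * (u 1 (- int n) - u 1 (int n)) -
      of_real (1 / (1 - q)) * (u (-1) (- int n) - u (-1) (int n))" for n
  proof -
    have "(\<Sum>p\<in>{- int n..<int n} \<times> {1, -1}. ?t p) = (\<Sum>\<epsilon>\<in>{1, -1}. \<Sum>k\<in>{- int n..<int n}. ?t (k, \<epsilon>))"
      by (subst sum.swap) (simp only: sum.cartesian_product case_prod_eta)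
    also have "\<dots> = (\<Sum>\<epsilon>\<in>{1, -1}. of_real (\<epsilon> / (1 - q)) * (u \<epsilon> (- int n) - u \<epsilon> (int n)))"
      by (intro sum.cong refl) (simp only: t sum_distrib_left[symmetric] sum_int_telescope)
    finally show ?thesis by (simp del: of_real_divide)
  qed
  have "(\<lambda>n. \<Sum>p\<in>{- int n..<int n} \<times> {1, -1}. ?t p) \<longlonglongrightarrow>
      of_real (1 / (1 - q)) * (0 - L) - of_real (1 / (1 - q)) * (0 - L)"
    unfolding sum_t by (intro tendsto_intros L N) auto
  \<comment> \<open>The unconditional sum may be evaluated along symmetric windows. This is where
    telescoping becomes legitimate, since u(k) and u(k + 1) need not be summable separately.\<close>
  moreover have "(\<lambda>n. \<Sum>p\<in>{- int n..<int n} \<times> {1, -1}. ?t p) \<longlonglongrightarrow> (\<Sum>\<^sub>\<infinity>p\<in>qindex. ?t p)"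
    using qintegrable_has_sum[OF D] unfolding has_sum_def
    by (rule filterlim_compose[OF _ filterlim_symmetric_qindex])
  ultimately have "(\<Sum>\<^sub>\<infinity>p\<in>qindex. ?t p) = 0"
    using LIMSEQ_unique by fastforce
  then show ?thesis by (simp add: qintegral_def)
qed

section \<open>Weighted l^1 bounds for iterated q-derivatives on the lattice\<close>

lemma qlattice_small_summable:
  fixes q \<gamma> :: real
  assumes q: "0 < q" "q < 1" and \<gamma>: "0 < \<gamma>"
  shows "(\<lambda>(k, \<epsilon>). if int N \<le> k then (q powi k * \<gamma>) ^ Suc m else 0) summable_on qindex"
proof -
  have "norm (q ^ Suc m) < 1"
    using q power_Suc_less_one[of q m] by (simp del: power_Suc)
  then have "summable (\<lambda>n. (q ^ N * \<gamma>) ^ Suc m * (q ^ Suc m) ^ n)"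
    by (rule summable_mult[OF summable_geometric])
  moreover have "(q ^ N * \<gamma>) ^ Suc m * (q ^ Suc m) ^ n = (q powi int (N + n) * \<gamma>) ^ Suc m" for n
  proof -
    have "(q ^ Suc m) ^ n = (q ^ n) ^ Suc m" by (simp only: power_mult[symmetric] mult.commute)
    then show ?thesis by (simp only: power_int_of_nat power_add power_mult_distrib mult_ac)
  qed
  ultimately have "summable (\<lambda>n. (q powi int (N + n) * \<gamma>) ^ Suc m)" by (simp only:)
  then have "(\<lambda>n. (q powi int (N + n) * \<gamma>) ^ Suc m) summable_on UNIV"
    using q \<gamma> by (subst summable_on_UNIV_nonneg_real_iff) auto
  moreover have "bij_betw (\<lambda>n. int (N + n)) UNIV {int N..}"
    by (rule bij_betwI[of _ _ _ "\<lambda>k. nat (k - int N)"]) auto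
  ultimately have "(\<lambda>k. (q powi k * \<gamma>) ^ Suc m) summable_on {int N..}"
    using summable_on_reindex_bij_betw[of "\<lambda>n. int (N + n)" UNIV "{int N..}" "\<lambda>k. (q powi k * \<gamma>) ^ Suc m"]
    by simp
  then have "(\<lambda>k. if int N \<le> k then (q powi k * \<gamma>) ^ Suc m else 0) summable_on UNIV"
    by (rule summable_on_cong_neutral[THEN iffD1, rotated -1]) auto
  then obtain S where S: "((\<lambda>k. if int N \<le> k then (q powi k * \<gamma>) ^ Suc m else 0) has_sum S) UNIV"
    by (auto simp: summable_on_def)
  show ?thesis
  proof (rule summable_on_SigmaI)
    show "((\<lambda>\<epsilon>. case (k, \<epsilon>) of (k, \<epsilon>) \<Rightarrow> if int N \<le> k then (q powi k * \<gamma>) ^ Suc m else 0) has_sum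
        2 * (if int N \<le> k then (q powi k * \<gamma>) ^ Suc m else 0)) {1, -1 :: real}" for k
      by (rule has_sum_finiteI) auto
    show "(\<lambda>k. 2 * (if int N \<le> k then (q powi k * \<gamma>) ^ Suc m else 0)) summable_on UNIV"
      using has_sum_cmult_right[OF S, of 2] by (auto simp: summable_on_def)
  qed (use q \<gamma> in auto)
qed

text \<open>Only the part of the lattice inside a small disk needs the pointwise bound \<open>B\<close>; outside,
  the denominator of the difference quotient is bounded below.\<close>

lemma qintegrable_qderiv:
  assumes q: "0 < q" "q < 1" and \<gamma>: "0 < \<gamma>" and G: "qlattice q \<gamma> \<subseteq> dom G"
    and int: "qintegrable q \<gamma> (\<lambda>x. the (G x) * x ^ m)"
    and B: "\<And>p. p \<in> qindex \<Longrightarrow> int N \<le> fst p \<Longrightarrow> norm (the (qderiv q G (qpoint q \<gamma> p))) \<le> B" "0 \<le> B"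
  shows "qintegrable q \<gamma> (\<lambda>x. the (qderiv q G x) * x ^ m)"
    and "(\<Sum>\<^sub>\<infinity>p\<in>qindex. norm (qint_term q \<gamma> (\<lambda>x. the (qderiv q G x) * x ^ m) p)) \<le>
      B * (\<Sum>\<^sub>\<infinity>(k, \<epsilon>)\<in>qindex. if int N \<le> k then (q powi k * \<gamma>) ^ Suc m else 0) +
      (1 + 1 / q ^ Suc m) / ((1 - q) * (q ^ N * \<gamma>)) *
        (\<Sum>\<^sub>\<infinity>p\<in>qindex. norm (qint_term q \<gamma> (\<lambda>x. the (G x) * x ^ m) p))"
proof -
  \<comment> \<open>The exponent \<open>Suc m\<close> joins the lattice weight |x| to the factor
    |x|^m. For indices below \<open>N\<close> one has |x| \<ge> q^N \<gamma>, so \<open>K\<close>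
    bounds the reciprocal of (1 - q) |x| there.\<close>
  define s where "s = (\<lambda>(k, \<epsilon> :: real). if int N \<le> k then (q powi k * \<gamma>) ^ Suc m else 0)"
  define K where "K = 1 / ((1 - q) * (q ^ N * \<gamma>))"
  have K: "0 < K" using q \<gamma> by (simp add: K_def)
  let ?F = "\<lambda>x. the (G x) * x ^ m" and ?D = "\<lambda>x. the (qderiv q G x) * x ^ m"
  let ?u = "\<lambda>p. norm (qint_term q \<gamma> ?F p)" and ?v = "\<lambda>p. norm (qint_term q \<gamma> (\<lambda>x. ?F (of_real q * x)) p)"
  have s: "s summable_on qindex"
    unfolding s_def by (rule qlattice_small_summable[OF q \<gamma>])
  have u: "?u summable_on qindex" using int by (simp add: qintegrable_def)
  have v: "?v summable_on qindex" using qintegrable_scale(1)[OF q(1) int] by (simp add: qintegrable_def)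
  \<comment> \<open>The terms in \<open>?v\<close> carry (q x)^m; the factor 1 / q^m restores
    x^m.\<close>
  have bound: "norm (qint_term q \<gamma> ?D p) \<le> B * s p + K * (?u p + (1 / q ^ m) * ?v p)" if p: "p \<in> qindex" for p
  proof -
    define x where "x = qpoint q \<gamma> p"
    define w where "w = q powi fst p * \<gamma>"
    have x: "x \<in> qlattice q \<gamma>" "norm x = w"
      using p q \<gamma> by (auto simp: x_def w_def qpoint_in_qlattice norm_qpoint simp del: mem_Sigma_iff)
    have w: "0 < w" using q \<gamma> by (simp add: w_def)
    have norm_term: "norm (qint_term q \<gamma> H p) = w * norm (H x)" for H
      using w by (simp add: qint_term_eq norm_mult flip: x_def w_def del: of_real_mult)
    show ?thesis
    proof (cases "int N \<le> fst p")
      case True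
      then have "norm (qint_term q \<gamma> ?D p) \<le> w * (B * w ^ m)"
        unfolding norm_term norm_mult norm_power x(2)
        using B(1)[OF p True] w by (intro mult_left_mono mult_right_mono) (auto simp: x_def)
      also have "\<dots> = B * s p" using True by (cases p) (simp add: s_def w_def)
      also have "\<dots> \<le> B * s p + K * (?u p + (1 / q ^ m) * ?v p)"
        using K q by simp
      finally show ?thesis .
    next
      case False
      then have "q powi int N \<le> q powi fst p"
        using q by (intro power_int_decreasing) auto
      then have w': "q ^ N * \<gamma> \<le> w" using \<gamma> by (simp add: w_def)
      have "norm (the (qderiv q G x)) = norm (the (G x) - the (G (of_real q * x))) * (1 / ((1 - q) * w))"
        using qderiv_qlattice[OF q(1) \<gamma> G x(1)] q x(2)
        by (simp add: norm_divide norm_mult del: of_real_diff)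
      also have "\<dots> \<le> (norm (the (G x)) + norm (the (G (of_real q * x)))) * K"
        unfolding K_def using q \<gamma> w w'
        by (intro mult_mono norm_triangle_ineq4 divide_left_mono mult_left_mono mult_pos_pos) auto
      finally have "w * (norm (the (qderiv q G x)) * w ^ m) \<le>
          w * ((norm (the (G x)) + norm (the (G (of_real q * x)))) * K * w ^ m)"
        using w by (intro mult_left_mono mult_right_mono) auto
      also have "\<dots> = K * (?u p + (1 / q ^ m) * ?v p)"
        using q w by (simp add: norm_term norm_mult norm_power x(2) power_mult_distrib field_simps)
      finally have "norm (qint_term q \<gamma> ?D p) \<le> K * (?u p + (1 / q ^ m) * ?v p)"
        by (simp add: norm_term norm_mult norm_power x(2))
      moreover have "s p = 0" using False by (cases p) (simp add: s_def)
      ultimately show ?thesis by simp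
    qed
  qed
  have hs: "((\<lambda>p. B * s p + K * (?u p + (1 / q ^ m) * ?v p)) has_sum
      B * infsum s qindex + K * (infsum ?u qindex + (1 / q ^ m) * infsum ?v qindex)) qindex"
    by (intro has_sum_add has_sum_cmult_right has_sum_infsum s u v)
  show *: "qintegrable q \<gamma> ?D"
    unfolding qintegrable_def
    by (rule Infinite_Sum.abs_summable_on_comparison_test'[OF has_sum_imp_summable[OF hs] bound])
  have "(\<Sum>\<^sub>\<infinity>p\<in>qindex. norm (qint_term q \<gamma> ?D p)) \<le>
      B * infsum s qindex + K * (infsum ?u qindex + (1 / q ^ m) * infsum ?v qindex)"
    using * bound unfolding qintegrable_def by (intro has_sum_mono[OF has_sum_infsum hs])
  also have "infsum ?v qindex = infsum ?u qindex / q"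
    by (rule qintegrable_scale(3)[OF q(1) int])
  also have "K * (infsum ?u qindex + (1 / q ^ m) * (infsum ?u qindex / q)) =
      (1 + 1 / q ^ Suc m) / ((1 - q) * (q ^ N * \<gamma>)) * infsum ?u qindex"
    using q by (simp add: K_def divide_simps) (simp add: algebra_simps)
  finally show "(\<Sum>\<^sub>\<infinity>p\<in>qindex. norm (qint_term q \<gamma> ?D p)) \<le>
      B * (\<Sum>\<^sub>\<infinity>(k, \<epsilon>)\<in>qindex. if int N \<le> k then (q powi k * \<gamma>) ^ Suc m else 0) +
      (1 + 1 / q ^ Suc m) / ((1 - q) * (q ^ N * \<gamma>)) * infsum ?u qindex"
    by (simp only: s_def)
qed

lemma qlattice_funpow_dom:
  assumes "0 < q" "0 < \<gamma>" "qlattice q \<gamma> \<subseteq> dom g"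
  shows "qlattice q \<gamma> \<subseteq> dom ((qderiv q ^^ e) g)"
proof (induction e)
  case (Suc e)
  then show ?case
    using assms by (auto simp: qderiv_qlattice)
qed (use assms in simp)

text \<open>The disk of the pointwise bounds does not shrink with the order, so a single
  \<open>N\<close> serves all orders. The norms a_e then satisfy a_(e+1) \<le> B0 R^(e+1) W + K a_e
  with constants independent of e, which forces growth of rate at most R + K.\<close>

lemma funpow_qderiv_norm_bound:
  assumes q: "0 < q" "q < 1" and \<gamma>: "0 < \<gamma>" and g: "g \<in> HD q \<gamma> (I_inf q \<gamma>)"
  obtains B M where "\<And>e. qintegrable q \<gamma> (\<lambda>x. the ((qderiv q ^^ e) g x) * x ^ m)"
    "\<And>e. (\<Sum>\<^sub>\<infinity>p\<in>qindex. norm (qint_term q \<gamma> (\<lambda>x. the ((qderiv q ^^ e) g x) * x ^ m) p)) \<le> B * M ^ e"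
proof -
  let ?D = "\<lambda>e. (qderiv q ^^ e) g"
  let ?a = "\<lambda>e. \<Sum>\<^sub>\<infinity>p\<in>qindex. norm (qint_term q \<gamma> (\<lambda>x. the (?D e x) * x ^ m) p)"
  from g obtain r F where r: "0 < r" and F: "F holomorphic_on ball 0 r"
    and eq: "\<And>x. x \<in> qlattice q \<gamma> \<Longrightarrow> x \<in> ball 0 r \<Longrightarrow> g x = Some (F x)"
    and dom: "qlattice q \<gamma> \<subseteq> dom g" and int: "qintegrable q \<gamma> (\<lambda>x. the (g x) * x ^ m)"
    by (auto simp: HD_def I_inf_def)
  define \<rho> where "\<rho> = r / 2"
  have \<rho>: "0 < \<rho>" "\<rho> < r" using r by (auto simp: \<rho>_def)
  obtain B0 where B0: "0 \<le> B0" "\<And>e x. x \<in> cball 0 \<rho> \<Longrightarrow>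
      norm ((hqderiv q ^^ e) F x) \<le> B0 * (2 / ((1 - q) * \<rho>)) ^ e"
    using funpow_hqderiv_bound[OF q F \<rho>] by blast
  have "(\<lambda>n. q ^ n * \<gamma>) \<longlonglongrightarrow> 0"
    using q by (intro tendsto_mult_left_zero LIMSEQ_power_zero) auto
  from order_tendstoD(2)[OF this \<rho>(1)] obtain N where N: "q ^ N * \<gamma> < \<rho>"
    by (auto simp: eventually_sequentially)
  define R where "R = 2 / ((1 - q) * \<rho>)"
  define W where "W = (\<Sum>\<^sub>\<infinity>(k, \<epsilon>)\<in>qindex. if int N \<le> k then (q powi k * \<gamma>) ^ Suc m else 0)"
  define K where "K = (1 + 1 / q ^ Suc m) / ((1 - q) * (q ^ N * \<gamma>))"
  have R: "0 < R" using q \<rho> by (simp add: R_def)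
  have K: "0 < K" using q \<gamma> by (auto simp: K_def intro!: divide_pos_pos add_pos_pos)
  have W: "0 \<le> W" unfolding W_def using q \<gamma> by (intro infsum_nonneg) auto
  have small: "norm (the (?D e (qpoint q \<gamma> p))) \<le> B0 * R ^ e" if p: "p \<in> qindex" "int N \<le> fst p" for e p
  proof -
    let ?x = "qpoint q \<gamma> p"
    have "q powi fst p \<le> q powi int N" using q p(2) by (intro power_int_decreasing) auto
    then have "q powi fst p * \<gamma> \<le> q ^ N * \<gamma>" using \<gamma> by simp
    then have x: "?x \<in> cball 0 \<rho>" "?x \<in> ball 0 r"
      using N \<rho> norm_qpoint[OF q(1) \<gamma> p(1)] by auto
    have "?D e ?x = Some ((hqderiv q ^^ e) F ?x)"
      using qlattice_nonzero[OF q(1) \<gamma>] qlattice_scale[OF q(1)] eq qpoint_in_qlattice[OF p(1)] x(2)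
      by (intro funpow_qderiv_lattice[OF q, of "qlattice q \<gamma>" r]) blast+
    then show ?thesis using B0(2)[OF x(1)] by (simp add: R_def)
  qed
  have step: "qintegrable q \<gamma> (\<lambda>x. the (?D (Suc e) x) * x ^ m) \<and>
      ?a (Suc e) \<le> B0 * R ^ Suc e * W + K * ?a e"
    if int_e: "qintegrable q \<gamma> (\<lambda>x. the (?D e x) * x ^ m)" for e
  proof -
    have bnd: "norm (the (qderiv q (?D e) (qpoint q \<gamma> p))) \<le> B0 * R ^ Suc e"
      if "p \<in> qindex" "int N \<le> fst p" for p
      using small[OF that, of "Suc e"] by simp
    have nonneg: "0 \<le> B0 * R ^ Suc e" using B0(1) R by simp
    show ?thesis
      using qintegrable_qderiv[OF q \<gamma> qlattice_funpow_dom[OF q(1) \<gamma> dom] int_e bnd nonneg]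
      by (simp only: W_def K_def funpow.simps o_def simp_thms)
  qed
  have int_all: "qintegrable q \<gamma> (\<lambda>x. the (?D e x) * x ^ m)" for e
    by (induction e) (use int step in auto)
  \<comment> \<open>One summand dominates the inhomogeneous term of the recursion, the other its
    initial value.\<close>
  define B where "B = B0 * W + ?a 0"
  have a: "0 \<le> ?a e" for e by (intro infsum_nonneg) simp
  have B: "B0 * W \<le> B" "0 \<le> B" using a[of 0] B0(1) W by (simp_all add: B_def)
  have "?a e \<le> B * (R + K) ^ e" for e
  proof (induction e)
    case 0
    then show ?case using B0(1) W by (simp add: B_def)
  next
    case (Suc e)
    have "?a (Suc e) \<le> (B0 * W) * (R ^ e * R) + K * ?a e"
      using step[OF int_all, of e] by (simp add: mult_ac)
    also have "\<dots> \<le> B * ((R + K) ^ e * R) + K * (B * (R + K) ^ e)"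
      using B B0(1) W R K by (intro add_mono mult_mono power_mono mult_left_mono Suc) auto
    also have "\<dots> = B * (R + K) ^ Suc e" by (simp add: algebra_simps)
    finally show ?case .
  qed
  with int_all show ?thesis by (rule that)
qed

subsection \<open>Moments of a convolution\<close>

lemma qderiv_HD:
  assumes q: "0 < q" "q < 1" and \<gamma>: "0 < \<gamma>" and g: "g \<in> HD q \<gamma> (I_inf q \<gamma>)"
  shows "qderiv q g \<in> HD q \<gamma> (I_inf q \<gamma>)"
proof -
  from g obtain r F where r: "0 < r" and F: "F holomorphic_on ball 0 r"
    and eq: "\<And>x. x \<in> qlattice q \<gamma> \<Longrightarrow> x \<in> ball 0 r \<Longrightarrow> g x = Some (F x)"
    and dom: "qlattice q \<gamma> \<subseteq> dom g"
    by (auto simp: HD_def I_inf_def)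
  have "qintegrable q \<gamma> (\<lambda>x. the (qderiv q g x) * x ^ m)" for m
  proof -
    obtain B M where "\<And>e. qintegrable q \<gamma> (\<lambda>x. the ((qderiv q ^^ e) g x) * x ^ m)"
      using funpow_qderiv_norm_bound[OF q \<gamma> g, of m] by blast
    from this[of 1] show ?thesis by simp
  qed
  then have "qderiv q g \<in> I_inf q \<gamma>"
    using qlattice_funpow_dom[OF q(1) \<gamma> dom, of 1] by (simp add: I_inf_def)
  moreover have "qderiv q g x = Some (hqderiv q F x)" if "x \<in> qlattice q \<gamma> \<inter> ball 0 r" for x
    using funpow_qderiv_lattice[OF q, of "qlattice q \<gamma>" r g F x 1] that eq
      qlattice_nonzero[OF q(1) \<gamma>] qlattice_scale[OF q(1)] by simp
  ultimately show ?thesis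
    unfolding HD_def using hqderiv_holomorphic[OF q F] r by blast
qed

lemma funpow_qderiv_HD:
  assumes "0 < q" "q < 1" "0 < \<gamma>" "g \<in> HD q \<gamma> (I_inf q \<gamma>)"
  shows "(qderiv q ^^ e) g \<in> HD q \<gamma> (I_inf q \<gamma>)"
  by (induction e) (use assms in \<open>auto intro: qderiv_HD\<close>)

text \<open>The prefactor q^((m^2 + m)/2) of the moments is tuned to this: from m to m + 1 it gains
  q^(m + 1), exactly the denominator left by integration by parts.\<close>

lemma qmoment_qderiv:
  assumes q: "0 < q" "q < 1" and \<gamma>: "0 < \<gamma>" and g: "g \<in> HD q \<gamma> (I_inf q \<gamma>)"
  shows "qmoment q \<gamma> 0 (qderiv q g) = 0"
    and "qmoment q \<gamma> (Suc m) (qderiv q g) = - of_real (qnum q (Suc m)) * qmoment q \<gamma> m g"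
proof -
  have "qderiv q g \<in> I_inf q \<gamma>" using qderiv_HD[OF q \<gamma> g] by (simp add: HD_def)
  then have "qintegrable q \<gamma> (\<lambda>x. the (qderiv q g x) * x ^ 0)" unfolding I_inf_def by blast
  then show "qmoment q \<gamma> 0 (qderiv q g) = 0"
    using qintegral_qderiv_0[OF q \<gamma> g] by (simp add: qmoment_def)
  have exponent: "((Suc m)\<^sup>2 + Suc m) div 2 = (m\<^sup>2 + m) div 2 + Suc m"
  proof -
    have "(Suc m)\<^sup>2 + Suc m = (m\<^sup>2 + m) + Suc m * 2" by (simp add: power2_eq_square)
    moreover have "(a + b * 2) div 2 = a div 2 + b" for a b :: nat by simp
    ultimately show ?thesis by (simp only:)
  qed
  have g': "g \<in> I_inf q \<gamma>" using g by (simp add: HD_def)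
  have "q ^ ((m\<^sup>2 + m) div 2 + Suc m) * (qnum q (Suc m) / q ^ Suc m) = qnum q (Suc m) * q ^ ((m\<^sup>2 + m) div 2)"
    using q by (simp add: power_add)
  then have "complex_of_real (q ^ ((m\<^sup>2 + m) div 2 + Suc m)) * of_real (qnum q (Suc m) / q ^ Suc m) =
      of_real (qnum q (Suc m)) * of_real (q ^ ((m\<^sup>2 + m) div 2))"
    by (simp only: of_real_mult[symmetric])
  then show "qmoment q \<gamma> (Suc m) (qderiv q g) = - of_real (qnum q (Suc m)) * qmoment q \<gamma> m g"
    unfolding qmoment_def qintegral_qderiv_Suc[OF q \<gamma> g'] exponent
    by (simp only: mult_minus_left mult_minus_right mult.assoc[symmetric])
qed

text \<open>Each q-derivative lowers the moment index by one, and at index 0 the next one gives 0.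
  The vanishing for e > m makes the moments of a convolution finite sums.\<close>

lemma qmoment_funpow_qderiv:
  assumes q: "0 < q" "q < 1" and \<gamma>: "0 < \<gamma>" and g: "g \<in> HD q \<gamma> (I_inf q \<gamma>)"
  shows "qmoment q \<gamma> m ((qderiv q ^^ e) g) =
    (if e \<le> m then (-1) ^ e * of_real (qfact q m / qfact q (m - e)) * qmoment q \<gamma> (m - e) g else 0)"
proof (induction e arbitrary: m)
  case 0
  then show ?case using qfact_ge_1[OF q, of m] by simp
next
  case (Suc e)
  note G = funpow_qderiv_HD[OF q \<gamma> g, of e]
  show ?case
  proof (cases m)
    case 0
    then show ?thesis using qmoment_qderiv(1)[OF q \<gamma> G] by simp
  next
    case (Suc n)
    then show ?thesis using qmoment_qderiv(2)[OF q \<gamma> G, of n] Suc.IH[of n] by (simp add: qfact_Suc)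
  qed
qed

text \<open>\<open>f\<close> acts only through its coefficients, which are summable against every
  geometric sequence, so its lattice may differ from that of \<open>g\<close>.\<close>

lemma
  assumes q: "0 < q" "q < 1" and \<gamma>: "0 < \<gamma>" and f: "f \<in> I_omega q \<gamma>0" and g: "g \<in> HD q \<gamma> (I_inf q \<gamma>)"
  shows qconv_in_I_inf: "qconv q \<gamma>0 f g \<in> I_inf q \<gamma>"
    and qcoeff_qconv: "qcoeff q \<gamma> (qconv q \<gamma>0 f g) m =
      (\<Sum>e\<le>m. qcoeff q \<gamma>0 f e * qcoeff q \<gamma> g (m - e))"
proof -
  let ?c = "qcoeff q \<gamma>0 f" and ?D = "\<lambda>e. (qderiv q ^^ e) g"
  let ?t = "\<lambda>m e. qint_term q \<gamma> (\<lambda>x. the (?D e x) * x ^ m)"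
  let ?s = "\<lambda>m. qint_term q \<gamma> (\<lambda>x. the (qconv q \<gamma>0 f g x) * x ^ m)"
  from g obtain r F where r: "0 < r" and F: "F holomorphic_on ball 0 r"
    and eq: "\<And>x. x \<in> qlattice q \<gamma> \<Longrightarrow> x \<in> ball 0 r \<Longrightarrow> g x = Some (F x)"
    and dom: "qlattice q \<gamma> \<subseteq> dom g"
    by (auto simp: HD_def I_inf_def)
  have bounded: "qexp_bounded q g x" if "x \<in> qlattice q \<gamma>" for x
    using qlattice_nonzero[OF q(1) \<gamma>] qlattice_scale[OF q(1)] that
    by (intro qexp_bounded_holomorphic[OF q F r _ eq dom]) auto
  note conv = qconv_exp_bounded[OF q f bounded]
  have swap: "((\<lambda>e. ?c e * infsum (?t m e) qindex) has_sum infsum (?s m) qindex) UNIV \<and>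
      ?s m summable_on qindex" for m
  proof -
    obtain B M where int: "\<And>e. qintegrable q \<gamma> (\<lambda>x. the (?D e x) * x ^ m)"
      and BM: "\<And>e. (\<Sum>\<^sub>\<infinity>p\<in>qindex. norm (?t m e p)) \<le> B * M ^ e"
      using funpow_qderiv_norm_bound[OF q \<gamma> g, of m] by blast
    define Z where "Z = (\<lambda>(e, p). ?c e * ?t m e p)"
    have "(\<lambda>z. norm (Z z)) summable_on UNIV \<times> qindex"
    proof (rule summable_on_SigmaI)
      show "((\<lambda>p. norm (Z (e, p))) has_sum norm (?c e) * (\<Sum>\<^sub>\<infinity>p\<in>qindex. norm (?t m e p))) qindex" for e
        using int[of e] unfolding Z_def qintegrable_def
        by (simp add: norm_mult) (intro has_sum_cmult_right has_sum_infsum)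
      have "summable (\<lambda>e. norm (?c e) * (\<Sum>\<^sub>\<infinity>p\<in>qindex. norm (?t m e p)))"
      proof (rule summable_comparison_test')
        show "summable (\<lambda>e. B * (norm (?c e) * M ^ e))"
          by (intro summable_mult I_omega_summable[OF q f])
        fix e
        have "0 \<le> (\<Sum>\<^sub>\<infinity>p\<in>qindex. norm (?t m e p))" by (intro infsum_nonneg) simp
        then show "norm (norm (?c e) * (\<Sum>\<^sub>\<infinity>p\<in>qindex. norm (?t m e p))) \<le> B * (norm (?c e) * M ^ e)"
          using mult_left_mono[OF BM[of e] norm_ge_zero[of "?c e"]] by (simp add: mult_ac)
      qed
      then show "(\<lambda>e. norm (?c e) * (\<Sum>\<^sub>\<infinity>p\<in>qindex. norm (?t m e p))) summable_on UNIV"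
        by (subst summable_on_UNIV_nonneg_real_iff) (auto intro!: mult_nonneg_nonneg infsum_nonneg)
    qed auto
    then obtain S where S: "(Z has_sum S) (UNIV \<times> qindex)"
      using Infinite_Sum.abs_summable_summable unfolding summable_on_def by blast
    have lhs: "((\<lambda>e. ?c e * infsum (?t m e) qindex) has_sum S) UNIV"
    proof (rule has_sum_SigmaD[OF S])
      show "((\<lambda>p. Z (e, p)) has_sum ?c e * infsum (?t m e) qindex) qindex" for e
        unfolding Z_def using has_sum_cmult_right[OF qintegrable_has_sum[OF int]] by simp
    qed
    have S': "((\<lambda>(p, e). Z (e, p)) has_sum S) (qindex \<times> UNIV)"
      using S by (rule has_sum_swap[THEN iffD1])
    have "(?s m has_sum S) qindex"
    proof (rule has_sum_SigmaD[OF S'])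
      fix p assume "p \<in> qindex"
      then have x: "qpoint q \<gamma> p \<in> qlattice q \<gamma>" by (rule qpoint_in_qlattice)
      let ?x = "qpoint q \<gamma> p"
      have "((\<lambda>e. ?c e * the (?D e ?x)) has_sum (\<Sum>e. ?c e * the (?D e ?x))) UNIV"
        by (rule norm_summable_imp_has_sum[OF conv(2)[OF x] summable_sums[OF summable_norm_cancel[OF conv(2)[OF x]]]])
      from has_sum_cmult_right[OF this, of "of_real (q powi fst p * \<gamma>) * ?x ^ m"]
      show "((\<lambda>e. case (p, e) of (p, e) \<Rightarrow> Z (e, p)) has_sum ?s m p) UNIV"
        by (simp add: Z_def qint_term_eq conv(1)[OF x] mult_ac)
    qed
    from infsumI[OF this] lhs has_sum_imp_summable[OF this] show ?thesis by simp
  qed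
  \<comment> \<open>For complex families unconditional summability is absolute, so the summability
    obtained from the interchange already is integrability.\<close>
  have "qintegrable q \<gamma> (\<lambda>x. the (qconv q \<gamma>0 f g x) * x ^ m)" for m
    unfolding qintegrable_def
    by (rule summable_on_iff_abs_summable_on_complex[THEN iffD1, OF swap[THEN conjunct2]])
  moreover have "qlattice q \<gamma> \<subseteq> dom (qconv q \<gamma>0 f g)"
    using conv(1) by blast
  ultimately show "qconv q \<gamma>0 f g \<in> I_inf q \<gamma>" by (simp add: I_inf_def)
  have "((\<lambda>e. ?c e * qmoment q \<gamma> m (?D e)) has_sum qmoment q \<gamma> m (qconv q \<gamma>0 f g)) UNIV"
    using has_sum_cmult_right[OF swap[of m, THEN conjunct1],
        of "of_real (q ^ ((m\<^sup>2 + m) div 2)) * of_real (1 - q)"]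
    by (simp only: qmoment_def qintegral_def mult_ac)
  moreover have "((\<lambda>e. ?c e * qmoment q \<gamma> m (?D e)) has_sum
      (\<Sum>e\<le>m. ?c e * qmoment q \<gamma> m (?D e))) UNIV"
    by (rule has_sum_finite_neutralI[where B = "{..m}"]) (auto simp: qmoment_funpow_qderiv[OF q \<gamma> g])
  ultimately have mom: "qmoment q \<gamma> m (qconv q \<gamma>0 f g) = (\<Sum>e\<le>m. ?c e * qmoment q \<gamma> m (?D e))"
    by (rule has_sum_unique)
  have "qcoeff q \<gamma> (qconv q \<gamma>0 f g) m =
      (-1) ^ m / of_real (qfact q m) * qmoment q \<gamma> m (qconv q \<gamma>0 f g)"
    by (simp add: qcoeff_def)
  also have "\<dots> = (\<Sum>e\<le>m. (-1) ^ m / of_real (qfact q m) * (?c e * qmoment q \<gamma> m (?D e)))"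
    by (simp only: mom sum_distrib_left)
  also have "\<dots> = (\<Sum>e\<le>m. ?c e * qcoeff q \<gamma> g (m - e))"
  \<comment> \<open>The sign (-1)^e from integration by parts turns (-1)^m into (-1)^(m - e), and
    the q-factorial of m cancels, leaving the coefficient of \<open>g\<close> at m - e.\<close>
  proof (intro sum.cong refl)
    fix e assume e: "e \<in> {..m}"
    have "(-1 :: complex) ^ m = (-1) ^ (m - e) * (-1) ^ e"
      using e by (simp flip: power_add)
    then have "(-1 :: complex) ^ m * (-1) ^ e = (-1) ^ (m - e)"
      by (simp add: mult.assoc flip: power_mult_distrib)
    moreover have "qfact q m \<noteq> 0" using qfact_ge_1[OF q, of m] by simp
    ultimately show "(-1) ^ m / of_real (qfact q m) * (?c e * qmoment q \<gamma> m (?D e)) =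
        ?c e * qcoeff q \<gamma> g (m - e)"
      using e by (simp add: qmoment_funpow_qderiv[OF q \<gamma> g] qcoeff_def[of q \<gamma> g] mult.assoc[symmetric])
  qed
  finally show "qcoeff q \<gamma> (qconv q \<gamma>0 f g) m = (\<Sum>e\<le>m. ?c e * qcoeff q \<gamma> g (m - e))" .
qed

theorem theorem4p8:
  fixes q \<gamma> \<gamma>' :: real and f g :: "complex \<rightharpoonup> complex"
  assumes "0 < q" and "q < 1" and "\<gamma> > 0" and "\<gamma>' > 0"
    and "f \<in> HD q \<gamma> (I_omega q \<gamma>)" and "g \<in> HD q \<gamma>' (I_omega q \<gamma>')"
  shows
    "(\<forall>(h :: complex \<rightharpoonup> complex) (\<Omega> :: complex set) x.
        (\<forall>e. \<Omega> \<subseteq> dom ((qderiv q ^^ e) h)) \<longrightarrow> x \<in> \<Omega> \<longrightarrow>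
        (\<exists>R>0. (\<lambda>e. norm (the ((qderiv q ^^ e) h x))) \<in> O(\<lambda>e. R ^ e)) \<longrightarrow>
        eq_at (qconv q \<gamma>' (qconv q \<gamma> f g) h) (qconv q \<gamma> f (qconv q \<gamma>' g h)) x) \<and>
     (\<forall>(h :: complex \<rightharpoonup> complex) (\<Omega> :: complex set).
        0 \<in> \<Omega> \<longrightarrow> (\<forall>x\<in>\<Omega>. closed_segment 0 x \<subseteq> \<Omega>) \<longrightarrow> pfun_analytic_on h \<Omega> \<longrightarrow>
        (\<forall>x\<in>\<Omega>. eq_at (qconv q \<gamma>' (qconv q \<gamma> f g) h) (qconv q \<gamma> f (qconv q \<gamma>' g h)) x)) \<and>
     (\<forall>(\<gamma>'' :: real) (h :: complex \<rightharpoonup> complex).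
        \<gamma>'' > 0 \<longrightarrow> h \<in> HD q \<gamma>'' (I_inf q \<gamma>'') \<longrightarrow>
        (\<forall>x\<in>qlattice q \<gamma>''.
           eq_at (qconv q \<gamma>' (qconv q \<gamma> f g) h) (qconv q \<gamma> f (qconv q \<gamma>' g h)) x))"
proof -
  note q = assms(1,2)
  have f: "f \<in> I_omega q \<gamma>" and g: "g \<in> I_omega q \<gamma>'" and g': "g \<in> HD q \<gamma>' (I_inf q \<gamma>')"
    using assms(5,6) by (auto simp: HD_def I_omega_I_inf)
  have assoc: "eq_at (qconv q \<gamma>' (qconv q \<gamma> f g) h) (qconv q \<gamma> f (qconv q \<gamma>' g h)) x"
    if "qexp_bounded q h x" for h x
    using qconv_assoc[OF q f g qconv_in_I_inf[OF q assms(4) f g'] qcoeff_qconv[OF q assms(4) f g'] that] .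
  show ?thesis
  proof (intro conjI allI impI ballI)
    fix h \<Omega> x
    assume "\<forall>e. \<Omega> \<subseteq> dom ((qderiv q ^^ e) h)" "x \<in> \<Omega>"
      and "\<exists>R>0. (\<lambda>e. norm (the ((qderiv q ^^ e) h x))) \<in> O(\<lambda>e. R ^ e)"
    then obtain R where R: "R > 0" "(\<lambda>e. norm (the ((qderiv q ^^ e) h x))) \<in> O(\<lambda>e. R ^ e)"
      and x: "\<And>e. x \<in> dom ((qderiv q ^^ e) h)"
      by blast
    from bigo_exp_bound[OF R(2)] R(1) obtain C where
      "\<And>e. norm (the ((qderiv q ^^ e) h x)) \<le> C * R ^ e"
      by auto
    then show "eq_at (qconv q \<gamma>' (qconv q \<gamma> f g) h) (qconv q \<gamma> f (qconv q \<gamma>' g h)) x"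
      by (intro assoc qexp_boundedI[OF x R(1)])
  next
    fix h \<Omega> x
    assume \<Omega>: "0 \<in> \<Omega>" "\<forall>x\<in>\<Omega>. closed_segment 0 x \<subseteq> \<Omega>" "pfun_analytic_on h \<Omega>" and x: "x \<in> \<Omega>"
    from \<Omega>(3) obtain U where U: "open U" "\<Omega> \<subseteq> U" "U \<subseteq> dom h" "(\<lambda>x. the (h x)) holomorphic_on U"
      by (auto simp: pfun_analytic_on_def)
    then obtain r where r: "0 < r" "ball 0 r \<subseteq> U"
      using \<Omega>(1) openE by (metis subsetD)
    have F: "(\<lambda>x. the (h x)) holomorphic_on ball 0 r"
      using U(4) r(2) by (rule holomorphic_on_subset)
    have hF: "h y = Some (the (h y))" if "y \<in> U" for y
      using that U(3) by force
    have "qexp_bounded q h x"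
    \<comment> \<open>The orbit argument excludes 0, which the disk around it covers. Every other
      point lies in \<open>\<Omega> - {0}\<close>, and this set is stable under multiplication by q
      because q y lies on the segment from 0 to y.\<close>
    proof (cases "x = 0")
      case True
      show ?thesis
        by (rule qexp_bounded_ball[OF q F]) (use hF r True in auto)
    next
      case False
      have scale: "of_real q * y \<in> \<Omega>" if "y \<in> \<Omega>" for y
      proof -
        have "of_real q * y \<in> closed_segment 0 y"
          unfolding in_segment using q by (intro exI[of _ q]) (simp add: scaleR_conv_of_real)
        then show ?thesis using \<Omega>(2) that by blast
      qed
      show ?thesis
        by (rule qexp_bounded_holomorphic[OF q F r(1), of "\<Omega> - {0}"])
          (use scale hF U q x False in auto)
    qed
    then show "eq_at (qconv q \<gamma>' (qconv q \<gamma> f g) h) (qconv q \<gamma> f (qconv q \<gamma>' g h)) x"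
      by (rule assoc)
  next
    fix \<gamma>'' h x
    assume \<gamma>'': "\<gamma>'' > 0" and h: "h \<in> HD q \<gamma>'' (I_inf q \<gamma>'')" and x: "x \<in> qlattice q \<gamma>''"
    from h obtain r F where "0 < r" "F holomorphic_on ball 0 r"
      "\<And>x. x \<in> qlattice q \<gamma>'' \<Longrightarrow> x \<in> ball 0 r \<Longrightarrow> h x = Some (F x)" "qlattice q \<gamma>'' \<subseteq> dom h"
      by (auto simp: HD_def I_inf_def)
    then have "qexp_bounded q h x"
      using qlattice_nonzero[OF q(1) \<gamma>''] qlattice_scale[OF q(1)] x
      by (intro qexp_bounded_holomorphic[OF q, of F r "qlattice q \<gamma>''"]) auto
    then show "eq_at (qconv q \<gamma>' (qconv q \<gamma> f g) h) (qconv q \<gamma> f (qconv q \<gamma>' g h)) x"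
      by (rule assoc)
  qed
qed

end
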